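(* Let $\mathcal O$ denote the set of oligomorphic closed subgroups of $S_\infty$, viewed as a Borel subset of the Effros Borel space of $S_\infty$. Then topological isomorphism on $\mathcal O$ is strongly Borel bi-reducible with the isomorphism relation on some isomorphism-invariant Borel set of countable structures in a finite signature. That is, there exist a finite signature $L$, an isomorphism-invariant Borel set $\mathcal B$ of $L$-structures with domain $\omega$, and Borel maps $\mathcal M\colon \mathcal O\to\mathcal B$ and $\mathcal G\colon \mathcal B\to\mathcal O$ such that: (i) $\mathcal G(\mathcal M(G))\cong G$ (topological group isomorphism) for every $G\in\mathcal O$; (ii) $\mathcal M(\mathcal G(M))\cong M$ for every $M\in\mathcal B$; (iii) for all $G,H\in\mathcal O$: $G\cong H\iff \mathcal M(G)\cong\mathcal M(H)$; (iv) for all $M,N\in\mathcal B$: $M\cong N\iff \mathcal G(M)\cong\mathcal G(N)$.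
   Context: $S_\infty$ is the Polish group of all permutations of $\omega=\{0,1,2,\dots\}$ with the topology of pointwise convergence. A closed subgroup $G$ of $S_\infty$ is oligomorphic if for every $n\ge 1$ the natural action of $G$ on $\omega^n$ has only finitely many orbits. Isomorphisms between groups are always topological group isomorphisms. The Effros Borel space of $S_\infty$ is the set of closed subsets of $S_\infty$ with the $\sigma$-algebra generated by the sets $\{D : D\cap U\neq\emptyset\}$ for $U\subseteq S_\infty$ open. For a countable signature $L$, $L$-structures with domain $\omega$ form a Polish space in the usual way (each relation is identified with an element of $2^{\omega^k}$); a set of such structures is isomorphism-invariant if it is closed under isomorphism. A map between standard Borel spaces is Borel if preimages of Borel sets are Borel. *)

theory Defs
  imports "HOL-Analysis.Analysis" "HOL-Algebra.Group_Action"
begin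

definition borel_of :: "'a topology \<Rightarrow> 'a measure" where
  "borel_of X = sigma (topspace X) {U. openin X U}"

definition S_inf :: "(nat \<Rightarrow> nat) monoid" where
  "S_inf = BijGroup UNIV"

text \<open>The topology on \<^typ>\<open>nat \<Rightarrow> nat\<close> is the product of the discrete topologies,
  i.e. pointwise convergence.\<close>

definition S_inf_top :: "(nat \<Rightarrow> nat) topology" where
  "S_inf_top = top_of_set (carrier S_inf)"

lemma carrier_S_inf: "carrier S_inf = {f. bij f}"
  by (auto simp: S_inf_def BijGroup_def Bij_def)

lemma mult_S_inf: "bij f \<Longrightarrow> bij g \<Longrightarrow> f \<otimes>\<^bsub>S_inf\<^esub> g = f \<circ> g"
  by (auto simp: S_inf_def BijGroup_def Bij_def compose_def)

lemma S_inf_top_eq: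
  "S_inf_top = subtopology (product_topology (\<lambda>_. discrete_topology UNIV) UNIV) {f. bij f}"
proof -
  have "(euclidean :: nat topology) = discrete_topology UNIV"
    by (simp add: topology_eq open_discrete)
  then show ?thesis
    by (simp add: S_inf_top_def carrier_S_inf flip: euclidean_product_topology)
qed

definition effros_S_inf :: "(nat \<Rightarrow> nat) set measure" where
  "effros_S_inf = sigma {D. closedin S_inf_top D}
     {{D. closedin S_inf_top D \<and> D \<inter> U \<noteq> {}} | U. openin S_inf_top U}"

definition subgrp :: "(nat \<Rightarrow> nat) set \<Rightarrow> (nat \<Rightarrow> nat) monoid" where
  "subgrp G = S_inf\<lparr>carrier := G\<rparr>"

text \<open>Elements of $\omega^n$ are lists of length \<open>n\<close>; a permutation \<open>g\<close> acts by \<^term>\<open>map g\<close>.\<close>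

definition oligomorphic_groups :: "(nat \<Rightarrow> nat) set set" where
  "oligomorphic_groups = {G. subgroup G S_inf \<and> closedin S_inf_top G \<and>
     (\<forall>n\<ge>1. finite (orbits (subgrp G) {xs :: nat list. length xs = n} map))}"

definition top_group_iso :: "(nat \<Rightarrow> nat) set \<Rightarrow> (nat \<Rightarrow> nat) set \<Rightarrow> bool" where
  "top_group_iso G H \<longleftrightarrow> (\<exists>\<phi> \<in> iso (subgrp G) (subgrp H).
     homeomorphic_map (subtopology S_inf_top G) (subtopology S_inf_top H) \<phi>)"

text \<open>A relational signature is a set \<open>L\<close> of relation symbols (without loss of generality natural
  numbers) with an arity function \<open>ar\<close>. A structure with domain $\omega$ is a point of the product
  over \<open>R \<in> L\<close> of the spaces $2^{\omega^{ar(R)}}$.\<close>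

definition finite_signature :: "nat set \<Rightarrow> (nat \<Rightarrow> nat) \<Rightarrow> bool" where
  "finite_signature L ar \<longleftrightarrow> finite L \<and> (\<forall>R\<in>L. ar R \<ge> 1)"

definition structure_top :: "nat set \<Rightarrow> (nat \<Rightarrow> nat) \<Rightarrow> (nat \<Rightarrow> nat list \<Rightarrow> bool) topology" where
  "structure_top L ar = product_topology
     (\<lambda>R. product_topology (\<lambda>_. discrete_topology (UNIV :: bool set)) {xs. length xs = ar R}) L"

abbreviation structures :: "nat set \<Rightarrow> (nat \<Rightarrow> nat) \<Rightarrow> (nat \<Rightarrow> nat list \<Rightarrow> bool) set" where
  "structures L ar \<equiv> topspace (structure_top L ar)"

lemma structures_eq:
  "structures L ar = (\<Pi>\<^sub>E R\<in>L. {xs. length xs = ar R} \<rightarrow>\<^sub>E UNIV)"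
  by (simp add: structure_top_def)

definition structure_iso ::
  "nat set \<Rightarrow> (nat \<Rightarrow> nat) \<Rightarrow> (nat \<Rightarrow> nat list \<Rightarrow> bool) \<Rightarrow> (nat \<Rightarrow> nat list \<Rightarrow> bool) \<Rightarrow> bool" where
  "structure_iso L ar M N \<longleftrightarrow> (\<exists>f. bij f \<and>
     (\<forall>R\<in>L. \<forall>xs. length xs = ar R \<longrightarrow> (M R xs \<longleftrightarrow> N R (map f xs))))"

definition iso_invariant ::
  "nat set \<Rightarrow> (nat \<Rightarrow> nat) \<Rightarrow> (nat \<Rightarrow> nat list \<Rightarrow> bool) set \<Rightarrow> bool" where
  "iso_invariant L ar B \<longleftrightarrow>
     (\<forall>M\<in>B. \<forall>N\<in>structures L ar. structure_iso L ar M N \<longrightarrow> N \<in> B)"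

end

theory Submission
  imports Defs
begin

text \<open>
  A closed subgroup \<open>G\<close> of the symmetric group is determined by its orbit equivalence relation \<open>T\<close> on
  finite tuples, and by back and forth the relations \<open>T\<close> that arise are described by countably many
  conditions on membership of pairs of tuples, which makes all sets below Borel.

  The structure attached to \<open>G\<close> has as elements the cosets of open subgroups of \<open>G\<close>, with the ternary
  relation \<open>A B \<subseteq> C\<close>. Oligomorphicity makes this set countable: an open coset is determined by
  finitely many orbits on tuples of a fixed length.

  Conversely, suppose an element \<open>V\<close> of an abstract structure has infinitely many left cosets, where
  being a left coset, and two tuples of left cosets being conjugate, are expressed through the ternary
  relation. The group attached to the structure is the closed group with these orbits, for the least
  \<open>V\<close> such that this group is oligomorphic, the action is a topological embedding, and the canonical
  map into the coset structure of the group is an isomorphism. The last condition is Borel and is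
  built into the definition of the class of structures, so no axiomatization of coset structures is
  needed. In the coset structure of \<open>G\<close> such a \<open>V\<close> exists: the stabiliser of a tuple that meets every
  orbit on points.
\<close>

section \<open>Traces and orbit systems\<close>

text \<open>Clauses (i) to (iv) all come from one relation: \<open>presents R G F\<close> says that
  \<open>F\<close> numbers the open cosets of \<open>G\<close> without repetition so that
  \<open>R\<close> becomes \<open>A B \<subseteq> C\<close>. A topological isomorphism carries open
  cosets to open cosets, so isomorphic groups have isomorphic structures. Conversely, the group
  rebuilt from \<open>R\<close> and a number \<open>V\<close> with \<open>good R V\<close> is
  topologically isomorphic to every oligomorphic group presented by \<open>R\<close>. Two groups
  with isomorphic structures are presented by the same \<open>R\<close> after renumbering, so both
  are isomorphic to one rebuilt group. This is also why the least \<open>V\<close> may be taken: it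
  depends on the numbering, but the isomorphism type of the rebuilt group does not. The delicate
  point is that the rebuilt group is closed by construction, while the image of \<open>G\<close> in
  the action on left cosets has to be shown closed; this rests on the condition in
  \<open>good\<close> that makes the action a topological embedding. A single relation symbol
  suffices because inclusion of open cosets is definable from \<open>A B \<subseteq> C\<close> as
  well.\<close>

abbreviation pinv :: "(nat \<Rightarrow> nat) \<Rightarrow> nat \<Rightarrow> nat" where
  "pinv \<equiv> inv_into UNIV"

lemma pinv_comp_left: "bij g \<Longrightarrow> pinv g \<circ> g = id"
  by (simp add: bij_is_inj)

lemma pinv_comp_right: "bij g \<Longrightarrow> g \<circ> pinv g = id"
  by (simp add: bij_is_surj surj_iff[symmetric])

lemma pinv_apply [simp]: "bij g \<Longrightarrow> pinv g (g a) = a" "bij g \<Longrightarrow> g (pinv g a) = a"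
  by (simp_all add: bij_is_inj bij_is_surj surj_f_inv_f)

lemma map_eq_iff_map_pinv: "bij g \<Longrightarrow> map g x = y \<longleftrightarrow> map (pinv g) y = x"
  by (auto simp: bij_is_inj pinv_comp_right)

definition tr :: "(nat \<Rightarrow> nat) set \<Rightarrow> nat list \<Rightarrow> nat list \<Rightarrow> bool" where
  "tr A x y \<longleftrightarrow> (\<exists>a\<in>A. map a x = y)"

text \<open>For a set \<open>A\<close> of permutations, \<open>tr A x y\<close> says that
  \<open>A\<close> meets the basic open set of permutations taking \<open>x\<close> to
  \<open>y\<close>, and \<open>pset (tr A)\<close> is the closure of \<open>A\<close>. So a closed
  set and its trace carry the same information.\<close>

definition pset :: "(nat list \<Rightarrow> nat list \<Rightarrow> bool) \<Rightarrow> (nat \<Rightarrow> nat) set" where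
  "pset t = {g. bij g \<and> (\<forall>x. t x (map g x))}"

lemma trI: "a \<in> A \<Longrightarrow> tr A x (map a x)"
  by (auto simp: tr_def)

lemma tr_length: "tr A x y \<Longrightarrow> length x = length y"
  by (auto simp: tr_def)

lemma pset_bij: "g \<in> pset t \<Longrightarrow> bij g"
  by (simp add: pset_def)

text \<open>These are the properties of orbit equivalence that a back-and-forth construction uses.
  The clause with \<open>is\<close> allows coordinates to be dropped, repeated and reordered; the
  last clause makes the limit map injective and, through symmetry, single-valued.\<close>

definition orbit_system :: "(nat list \<Rightarrow> nat list \<Rightarrow> bool) \<Rightarrow> bool" where
  "orbit_system T \<longleftrightarrow>
     (\<forall>x. T x x) \<and> (\<forall>x y. T x y \<longrightarrow> T y x) \<and> (\<forall>x y z. T x y \<longrightarrow> T y z \<longrightarrow> T x z) \<and>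
     (\<forall>x y. T x y \<longrightarrow> length x = length y) \<and>
     (\<forall>x y is. T x y \<longrightarrow> (\<forall>i\<in>set is. i < length x) \<longrightarrow> T (map ((!) x) is) (map ((!) y) is)) \<and>
     (\<forall>x y a. T x y \<longrightarrow> (\<exists>b. T (x @ [a]) (y @ [b]))) \<and>
     (\<forall>a a' b. T [a, a'] [b, b] \<longrightarrow> a = a')"

text \<open>Finiteness is stated through a list of representatives so that the existential
  quantifier ranges over a countable type.\<close>

definition finite_reps :: "(nat list \<Rightarrow> nat list \<Rightarrow> bool) \<Rightarrow> bool" where
  "finite_reps T \<longleftrightarrow> (\<forall>n. \<exists>zs. \<forall>x. length x = n \<longrightarrow> (\<exists>z\<in>set zs. T z x))"

locale perm_group =
  fixes G :: "(nat \<Rightarrow> nat) set"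
  assumes bij_mem: "g \<in> G \<Longrightarrow> bij g"
    and id_mem: "id \<in> G"
    and comp_mem: "g \<in> G \<Longrightarrow> h \<in> G \<Longrightarrow> g \<circ> h \<in> G"
    and inv_mem: "g \<in> G \<Longrightarrow> pinv g \<in> G"
begin

lemma orbit_system_tr: "orbit_system (tr G)"
  unfolding orbit_system_def
proof (intro conjI allI impI)
  show "tr G x x" for x
    using trI[OF id_mem, of x] by simp
  show "tr G y x" if xy: "tr G x y" for x y
  proof -
    obtain g where g: "g \<in> G" "map g x = y" using xy by (auto simp: tr_def)
    then have "map (pinv g) y = x" using map_eq_iff_map_pinv[OF bij_mem] by blast
    then show ?thesis using inv_mem[OF g(1)] by (auto simp: tr_def)
  qed
  show "tr G x z" if xyz: "tr G x y" "tr G y z" for x y z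
  proof -
    obtain g h where g: "g \<in> G" "map g x = y" and h: "h \<in> G" "map h y = z"
      using xyz by (auto simp: tr_def)
    then have "map (h \<circ> g) x = z" by auto
    then show ?thesis using comp_mem[OF h(1) g(1)] by (auto simp: tr_def)
  qed
  show "length x = length y" if "tr G x y" for x y
    using that by (rule tr_length)
  show "tr G (map ((!) x) is) (map ((!) y) is)" if "tr G x y" "\<forall>i\<in>set is. i < length x" for x y "is"
    using that by (force simp: tr_def)
  show "\<exists>b. tr G (x @ [a]) (y @ [b])" if "tr G x y" for x y a
    using that by (auto simp: tr_def)
  show "a = a'" if "tr G [a, a'] [b, b]" for a a' b
    using that bij_mem by (auto simp: tr_def bij_def inj_def)
qed

end

locale closed_group = perm_group +
  assumes closed_mem: "pset (tr G) \<subseteq> G"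

lemma closed_group_bij: "closed_group G \<Longrightarrow> g \<in> G \<Longrightarrow> bij g"
  by (simp add: closed_group_def perm_group_def)

lemma
  assumes "orbit_system T"
  shows orbit_system_refl: "T x x"
    and orbit_system_sym: "T x y \<Longrightarrow> T y x"
    and orbit_system_trans: "T x y \<Longrightarrow> T y z \<Longrightarrow> T x z"
    and orbit_system_length: "T x y \<Longrightarrow> length x = length y"
    and orbit_system_nths: "T x y \<Longrightarrow> (\<And>i. i \<in> set is \<Longrightarrow> i < length x) \<Longrightarrow>
      T (map ((!) x) is) (map ((!) y) is)"
    and orbit_system_snoc: "T x y \<Longrightarrow> \<exists>b. T (x @ [a]) (y @ [b])"
    and orbit_system_inj: "T [a, a'] [b, b] \<Longrightarrow> a = a'"
proof -
  have T: "\<forall>x. T x x" "\<forall>x y. T x y \<longrightarrow> T y x" "\<forall>x y z. T x y \<longrightarrow> T y z \<longrightarrow> T x z"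
    "\<forall>x y. T x y \<longrightarrow> length x = length y"
    "\<forall>x y is. T x y \<longrightarrow> (\<forall>i\<in>set is. i < length x) \<longrightarrow> T (map ((!) x) is) (map ((!) y) is)"
    "\<forall>x y a. T x y \<longrightarrow> (\<exists>b. T (x @ [a]) (y @ [b]))" "\<forall>a a' b. T [a, a'] [b, b] \<longrightarrow> a = a'"
    using assms unfolding orbit_system_def by - (elim conjE, assumption)+
  show "T x x" using T(1) by blast
  show "T x y \<Longrightarrow> T y x" using T(2) by blast
  show "T x y \<Longrightarrow> T y z \<Longrightarrow> T x z" using T(3) by blast
  show "T x y \<Longrightarrow> length x = length y" using T(4) by blast
  show "T x y \<Longrightarrow> (\<And>i. i \<in> set is \<Longrightarrow> i < length x) \<Longrightarrow> T (map ((!) x) is) (map ((!) y) is)"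
    using T(5) by simp
  show "T x y \<Longrightarrow> \<exists>b. T (x @ [a]) (y @ [b])" using T(6) by simp
  show "T [a, a'] [b, b] \<Longrightarrow> a = a'" using T(7) by blast
qed

text \<open>Every coordinate pair of \<open>(u, v)\<close> is one of \<open>(x, y)\<close>, so
  \<open>u\<close> and \<open>v\<close> are read off from \<open>x\<close> and \<open>y\<close>
  along a common list of indices. This lets tuples be handled as finite partial maps.\<close>

lemma orbit_system_sublist:
  assumes "orbit_system T" "T x y" "\<And>a b. (a, b) \<in> set (zip u v) \<Longrightarrow> (a, b) \<in> set (zip x y)"
    "length u = length v"
  shows "T u v"
proof -
  have "\<exists>i<length x. x ! i = u ! k \<and> y ! i = v ! k" if "k < length u" for k
  proof -
    have "(u ! k, v ! k) \<in> set (zip x y)"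
      using that by (intro assms(3)) (auto simp: set_zip assms(4))
    then show ?thesis
      by (auto simp: in_set_conv_nth)
  qed
  then obtain f where f: "\<And>k. k < length u \<Longrightarrow> f k < length x \<and> x ! f k = u ! k \<and> y ! f k = v ! k"
    by metis
  let ?is = "map f [0..<length u]"
  have "T (map ((!) x) ?is) (map ((!) y) ?is)"
    using f by (intro orbit_system_nths[OF assms(1,2)]) auto
  moreover have "map ((!) x) ?is = u" "map ((!) y) ?is = v"
    using f assms(4) by (auto intro!: nth_equalityI)
  ultimately show ?thesis
    by simp
qed

text \<open>Back and forth: stage \<open>n\<close> puts the number \<open>n\<close> into the domain
  and the range of a finite partial map whose two sides stay related by \<open>T\<close>. The union
  of the stages is the permutation.\<close>

lemma orbit_system_extends:
  assumes T: "orbit_system T" and xy: "T x y"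
  shows "\<exists>g\<in>pset T. map g x = y"
proof -
  have sym: "T u v \<Longrightarrow> T v u" and ext: "T u v \<Longrightarrow> \<exists>b. T (u @ [a]) (v @ [b])"
    and len: "T u v \<Longrightarrow> length u = length v" for u v a
    using orbit_system_sym[OF T] orbit_system_snoc[OF T] orbit_system_length[OF T] by blast+
  \<comment> \<open>One stage: extend on the left by \<open>n\<close>, swap the two sides, extend by
    \<open>n\<close> again, swap back.\<close>
  have ext2: "\<exists>a b. T (u @ [n, a]) (v @ [b, n])" if uv: "T u v" for u v n
  proof -
    obtain b where "T (u @ [n]) (v @ [b])" using ext[OF uv] by blast
    from ext[OF sym[OF this], of n] obtain a where "T ((v @ [b]) @ [n]) ((u @ [n]) @ [a])" by blast
    then have "T (u @ [n, a]) (v @ [b, n])" using sym by simp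
    then show ?thesis by blast
  qed
  have "\<exists>p. p 0 = (x, y) \<and> (\<forall>n. T (fst (p n)) (snd (p n)) \<and>
      (\<exists>a b. p (Suc n) = (fst (p n) @ [n, a], snd (p n) @ [b, n])))"
  proof -
    \<comment> \<open>Dependent choice does not prescribe a starting point; the clause for
      \<open>n = 0\<close> pins it at \<open>(x, y)\<close>.\<close>
    define P where "P = (\<lambda>(n :: nat) (p :: nat list \<times> nat list). T (fst p) (snd p) \<and> (n = 0 \<longrightarrow> p = (x, y)))"
    have "\<exists>p. \<forall>n. P n (p n) \<and> (\<exists>a b. p (Suc n) = (fst (p n) @ [n, a], snd (p n) @ [b, n]))"
    proof (rule dependent_nat_choice)
      show "\<exists>p. P 0 p" using xy by (auto simp: P_def)
      show "\<exists>q. P (Suc n) q \<and> (\<exists>a b. q = (fst p @ [n, a], snd p @ [b, n]))" if "P n p" for p n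
        using ext2[of "fst p" "snd p" n] that by (auto simp: P_def)
    qed
    then show ?thesis by (auto simp: P_def)
  qed
  then obtain p where p0: "p 0 = (x, y)" and pT: "\<And>n. T (fst (p n)) (snd (p n))"
    and pS: "\<And>n. \<exists>a b. p (Suc n) = (fst (p n) @ [n, a], snd (p n) @ [b, n])"
    by blast
  define Q where "Q n = set (zip (fst (p n)) (snd (p n)))" for n
  have QS: "Q n \<subseteq> Q (Suc n)" for n
    using pS[of n] len[OF pT] by (auto simp: Q_def)
  then have Qmono: "m \<le> n \<Longrightarrow> Q m \<subseteq> Q n" for m n
    by (rule lift_Suc_mono_le)
  \<comment> \<open>Pairs from two stages lie together at the later one, so the last clause of
    \<open>orbit_system\<close> compares them.\<close>
  have common: "T [a, a'] [b, b']" if "(a, b) \<in> Q m" "(a', b') \<in> Q n" for a b a' b' m n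
  proof (rule orbit_system_sublist[OF T pT[of "max m n"]])
    show "(c, d) \<in> set (zip (fst (p (max m n))) (snd (p (max m n))))"
      if "(c, d) \<in> set (zip [a, a'] [b, b'])" for c d
      using that \<open>(a, b) \<in> Q m\<close> \<open>(a', b') \<in> Q n\<close> Qmono[of m "max m n"] Qmono[of n "max m n"]
      by (auto simp: Q_def)
  qed simp
  have fun_Q: "b = b'" if "(a, b) \<in> Q m" "(a, b') \<in> Q n" for a b b' m n
    using orbit_system_inj[OF T sym[OF common[OF that]]] .
  have inj_Q: "a = a'" if "(a, b) \<in> Q m" "(a', b) \<in> Q n" for a a' b m n
    using orbit_system_inj[OF T common[OF that]] .
  have tot_Q: "\<exists>b. (a, b) \<in> Q (Suc a)" for a
    using pS[of a] len[OF pT[of a]] by (auto simp: Q_def)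
  have sur_Q: "\<exists>a. (a, b) \<in> Q (Suc b)" for b
    using pS[of b] len[OF pT[of b]] by (auto simp: Q_def)
  obtain g where g: "\<And>a. (a, g a) \<in> Q (Suc a)"
    using tot_Q by metis
  have g_eq: "(a, b) \<in> Q n \<Longrightarrow> g a = b" for a b n
    using fun_Q g by blast
  have "bij g"
  proof (rule bijI)
    show "inj g" by (rule injI) (metis g inj_Q)
    show "surj g" by (metis surj_def sur_Q g_eq)
  qed
  moreover have "T u (map g u)" for u
  proof -
    \<comment> \<open>By stage \<open>Suc a\<close> the number \<open>a\<close> is in the domain, so
      this stage covers all of \<open>u\<close>; inserting \<open>0\<close> keeps \<open>Max\<close>
      defined for the empty tuple.\<close>
    define n where "n = Suc (Max (insert 0 (set u)))"
    have "(a, g a) \<in> Q n" if "a \<in> set u" for a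
    proof -
      have "Suc a \<le> n" using that by (auto simp: n_def)
      then show ?thesis using g Qmono by blast
    qed
    then show ?thesis
      by (intro orbit_system_sublist[OF T pT[of n]]) (auto simp: Q_def set_zip)
  qed
  moreover have "map g x = y"
    using g_eq[of _ _ 0] p0 len[OF xy] by (intro nth_equalityI) (auto simp: Q_def set_zip)
  ultimately show ?thesis
    by (auto simp: pset_def)
qed

text \<open>The inclusion with content is \<open>orbit_system_extends\<close>. Together with
  \<open>closed_group_pset\<close> it makes orbit systems and closed groups two descriptions of the
  same objects.\<close>

lemma tr_pset: "orbit_system T \<Longrightarrow> tr (pset T) = T"
  unfolding tr_def fun_eq_iff using orbit_system_extends[of T] unfolding pset_def by blast

lemma closed_group_pset:
  assumes T: "orbit_system T"
  shows "closed_group (pset T)"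
proof
  show "bij g" if "g \<in> pset T" for g using that by (rule pset_bij)
  show "id \<in> pset T" by (simp add: pset_def orbit_system_refl[OF T])
  show "g \<circ> h \<in> pset T" if "g \<in> pset T" "h \<in> pset T" for g h
  proof -
    have "T x (map g (map h x))" for x
      by (rule orbit_system_trans[OF T, of x "map h x" "map g (map h x)"])
        (use that in \<open>simp_all add: pset_def del: map_map\<close>)
    then show ?thesis
      using that by (simp add: pset_def bij_comp)
  qed
  show "pinv g \<in> pset T" if "g \<in> pset T" for g
  proof -
    have "T (map (pinv g) x) (map g (map (pinv g) x))" for x
      using that by (simp add: pset_def del: map_map)
    then have "T (map (pinv g) x) x" for x
      using that by (simp add: pset_def pinv_comp_right)
    then show ?thesis
      using that orbit_system_sym[OF T] by (simp add: pset_def bij_imp_bij_inv)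
  qed
  show "pset (tr (pset T)) \<subseteq> pset T" by (simp add: tr_pset[OF T])
qed

section \<open>Permutation groups and their topology\<close>

text \<open>A basic open set of the product restricts finitely many coordinates; the tuple
  \<open>x\<close> lists them.\<close>

lemma openin_S_inf_top:
  "openin S_inf_top U \<longleftrightarrow>
     U \<subseteq> {f. bij f} \<and> (\<forall>g\<in>U. \<exists>x. \<forall>h. bij h \<longrightarrow> map h x = map g x \<longrightarrow> h \<in> U)"
proof
  assume "openin S_inf_top U"
  then obtain W where W: "openin (product_topology (\<lambda>_. discrete_topology UNIV) UNIV) W"
    and U: "U = W \<inter> {f. bij f}"
    by (auto simp: S_inf_top_eq openin_subtopology)
  have "\<exists>x. \<forall>h. bij h \<longrightarrow> map h x = map g x \<longrightarrow> h \<in> U" if "g \<in> U" for g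
  proof -
    have "g \<in> W" using that U by blast
    then obtain N :: "nat \<Rightarrow> nat set" where N: "finite {i. N i \<noteq> UNIV}" "g \<in> Pi\<^sub>E UNIV N" "Pi\<^sub>E UNIV N \<subseteq> W"
      using W unfolding openin_product_topology_alt by fastforce
    obtain x where x: "set x = {i. N i \<noteq> UNIV}"
      using finite_list[OF N(1)] by blast
    have "h \<in> U" if "bij h" "map h x = map g x" for h
    proof -
      have "h i \<in> N i" for i
        using that(2) N(2) x by (cases "N i = UNIV") (auto simp: PiE_def)
      then show ?thesis using N(3) U that(1) by (auto simp: PiE_def)
    qed
    then show ?thesis by blast
  qed
  then show "U \<subseteq> {f. bij f} \<and> (\<forall>g\<in>U. \<exists>x. \<forall>h. bij h \<longrightarrow> map h x = map g x \<longrightarrow> h \<in> U)"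
    using U by blast
next
  assume R: "U \<subseteq> {f. bij f} \<and> (\<forall>g\<in>U. \<exists>x. \<forall>h. bij h \<longrightarrow> map h x = map g x \<longrightarrow> h \<in> U)"
  \<comment> \<open>An open set of arbitrary functions whose permutations are exactly the members of
    \<open>U\<close>; \<open>f\<close> need not be bijective.\<close>
  define W where "W = {f. \<exists>g\<in>U. \<exists>x. (\<forall>h. bij h \<longrightarrow> map h x = map g x \<longrightarrow> h \<in> U) \<and> map f x = map g x}"
  have "openin (product_topology (\<lambda>_. discrete_topology UNIV) UNIV) W"
    unfolding openin_product_topology_alt
  proof
    fix f assume "f \<in> W"
    then obtain g x where g: "g \<in> U" "\<forall>h. bij h \<longrightarrow> map h x = map g x \<longrightarrow> h \<in> U" "map f x = map g x"
      by (auto simp: W_def)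
    define N where "N i = (if i \<in> set x then {f i} else UNIV)" for i
    have "finite {i \<in> UNIV. N i \<noteq> topspace (discrete_topology UNIV)}"
      by (rule finite_subset[of _ "set x"]) (auto simp: N_def)
    moreover have "Pi\<^sub>E UNIV N \<subseteq> W"
    proof
      fix h assume "h \<in> Pi\<^sub>E UNIV N"
      then have "map h x = map f x" by (auto simp: N_def PiE_def Pi_def split: if_splits)
      then show "h \<in> W" using g by (auto simp: W_def)
    qed
    ultimately show "\<exists>N. finite {i \<in> UNIV. N i \<noteq> topspace (discrete_topology UNIV)} \<and>
        (\<forall>i\<in>UNIV. openin (discrete_topology UNIV) (N i)) \<and> f \<in> Pi\<^sub>E UNIV N \<and> Pi\<^sub>E UNIV N \<subseteq> W"
      by (intro exI[of _ N]) (auto simp: N_def)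
  qed
  moreover have "U = W \<inter> {f. bij f}"
  proof
    show "U \<subseteq> W \<inter> {f. bij f}"
    proof
      fix g assume "g \<in> U"
      moreover obtain x where "\<forall>h. bij h \<longrightarrow> map h x = map g x \<longrightarrow> h \<in> U"
        using R \<open>g \<in> U\<close> by blast
      ultimately show "g \<in> W \<inter> {f. bij f}" using R unfolding W_def by blast
    qed
    show "W \<inter> {f. bij f} \<subseteq> U" by (auto simp: W_def)
  qed
  ultimately show "openin S_inf_top U"
    by (auto simp: S_inf_top_eq openin_subtopology)
qed

lemma topspace_S_inf_top: "topspace S_inf_top = {f. bij f}"
  by (simp add: S_inf_top_eq)

lemma closedin_S_inf_top:
  "closedin S_inf_top D \<longleftrightarrow> D \<subseteq> {f. bij f} \<and> pset (tr D) \<subseteq> D"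
proof
  assume D: "closedin S_inf_top D"
  have "g \<in> D" if g: "g \<in> pset (tr D)" for g
  proof (rule ccontr)
    assume "g \<notin> D"
    then have "g \<in> {f. bij f} - D" using g pset_bij by blast
    moreover have "openin S_inf_top ({f. bij f} - D)"
      using D by (simp add: closedin_def topspace_S_inf_top)
    ultimately obtain x where x: "\<forall>h. bij h \<longrightarrow> map h x = map g x \<longrightarrow> h \<in> {f. bij f} - D"
      unfolding openin_S_inf_top by blast
    obtain h where "h \<in> D" "map h x = map g x" using g by (auto simp: pset_def tr_def)
    moreover have "bij h" using \<open>h \<in> D\<close> closedin_subset[OF D] by (auto simp: topspace_S_inf_top)
    ultimately show False using x by blast
  qed
  then show "D \<subseteq> {f. bij f} \<and> pset (tr D) \<subseteq> D"
    using closedin_subset[OF D] by (auto simp: topspace_S_inf_top)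
next
  assume D: "D \<subseteq> {f. bij f} \<and> pset (tr D) \<subseteq> D"
  have "openin S_inf_top ({f. bij f} - D)"
    unfolding openin_S_inf_top
  proof (intro conjI ballI)
    fix g assume g: "g \<in> {f. bij f} - D"
    then have "g \<notin> pset (tr D)" using D by blast
    then obtain x where "\<not> tr D x (map g x)" using g by (auto simp: pset_def)
    then show "\<exists>x. \<forall>h. bij h \<longrightarrow> map h x = map g x \<longrightarrow> h \<in> {f. bij f} - D"
      by (intro exI[of _ x]) (metis DiffI mem_Collect_eq trI)
  qed blast
  then show "closedin S_inf_top D"
    using D by (simp add: closedin_def topspace_S_inf_top)
qed

lemma subgroup_S_inf:
  "subgroup G S_inf \<longleftrightarrow> G \<subseteq> {f. bij f} \<and> id \<in> G \<and> (\<forall>g\<in>G. \<forall>h\<in>G. g \<circ> h \<in> G) \<and> (\<forall>g\<in>G. pinv g \<in> G)"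
proof -
  have grp: "group S_inf" by (simp add: S_inf_def group_BijGroup)
  have one: "\<one>\<^bsub>S_inf\<^esub> = id" by (auto simp: S_inf_def BijGroup_def)
  have inv: "inv\<^bsub>S_inf\<^esub> g = pinv g" if "bij g" for g
  proof (rule group.inv_equality[OF grp])
    show "pinv g \<otimes>\<^bsub>S_inf\<^esub> g = \<one>\<^bsub>S_inf\<^esub>"
      using that by (simp add: mult_S_inf bij_imp_bij_inv one bij_is_inj)
  qed (use that in \<open>auto simp: carrier_S_inf bij_imp_bij_inv\<close>)
  show ?thesis
  proof
    assume G: "subgroup G S_inf"
    then have sub: "G \<subseteq> {f. bij f}" using subgroup.subset carrier_S_inf by blast
    show "G \<subseteq> {f. bij f} \<and> id \<in> G \<and> (\<forall>g\<in>G. \<forall>h\<in>G. g \<circ> h \<in> G) \<and> (\<forall>g\<in>G. pinv g \<in> G)"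
    proof (intro conjI ballI sub)
      show "id \<in> G" using subgroup.one_closed[OF G] one by simp
      show "g \<circ> h \<in> G" if "g \<in> G" "h \<in> G" for g h
        using subgroup.m_closed[OF G that] that sub by (simp add: mult_S_inf subset_iff)
      show "pinv g \<in> G" if "g \<in> G" for g
        using subgroup.m_inv_closed[OF G that] that sub inv[of g] by (simp add: subset_iff)
    qed
  next
    assume G: "G \<subseteq> {f. bij f} \<and> id \<in> G \<and> (\<forall>g\<in>G. \<forall>h\<in>G. g \<circ> h \<in> G) \<and> (\<forall>g\<in>G. pinv g \<in> G)"
    show "subgroup G S_inf"
      by (unfold_locales) (use G in \<open>auto simp: carrier_S_inf mult_S_inf one inv subset_iff\<close>)
  qed
qed

lemma closed_group_iff: "closed_group G \<longleftrightarrow> subgroup G S_inf \<and> closedin S_inf_top G"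
  by (auto simp: closed_group_def perm_group_def closed_group_axioms_def closedin_S_inf_top subgroup_S_inf)

lemma (in closed_group) finite_orbits_iff:
  "(\<forall>n\<ge>1. finite (orbits (subgrp G) {xs :: nat list. length xs = n} map)) \<longleftrightarrow> finite_reps (tr G)"
proof -
  have orb: "orbit (subgrp G) map x = {y. tr G x y}" for x
    by (auto simp: orbit_def subgrp_def tr_def)
  have T: "tr G x x" "tr G x y \<Longrightarrow> tr G y x" "tr G x y \<Longrightarrow> tr G y z \<Longrightarrow> tr G x z" for x y z
    using orbit_system_refl[OF orbit_system_tr] orbit_system_sym[OF orbit_system_tr]
      orbit_system_trans[OF orbit_system_tr] by blast+
  have eq: "orbits (subgrp G) {xs. length xs = n} map = (\<lambda>x. {y. tr G x y}) ` {xs. length xs = n}" for n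
    by (auto simp: orbits_def orb)
  have fin: "finite (orbits (subgrp G) {xs. length xs = n} map) \<longleftrightarrow>
      (\<exists>zs. \<forall>x. length x = n \<longrightarrow> (\<exists>z\<in>set zs. tr G z x))" for n
  proof
    assume "finite (orbits (subgrp G) {xs. length xs = n} map)"
    then obtain C where C: "finite C" "C \<subseteq> {xs. length xs = n}"
      "(\<lambda>x. {y. tr G x y}) ` {xs. length xs = n} = (\<lambda>x. {y. tr G x y}) ` C"
      unfolding eq by (meson finite_subset_image order_refl)
    obtain zs where zs: "set zs = C" using finite_list[OF C(1)] by blast
    have "\<exists>z\<in>set zs. tr G z x" if x: "length x = n" for x
    proof -
      obtain z where "z \<in> C" "{y. tr G x y} = {y. tr G z y}" using C(3) x by blast
      then show ?thesis using zs T(1)[of x] by blast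
    qed
    then show "\<exists>zs. \<forall>x. length x = n \<longrightarrow> (\<exists>z\<in>set zs. tr G z x)" by blast
  next
    assume "\<exists>zs. \<forall>x. length x = n \<longrightarrow> (\<exists>z\<in>set zs. tr G z x)"
    then obtain zs where zs: "\<And>x. length x = n \<Longrightarrow> \<exists>z\<in>set zs. tr G z x" by blast
    have "orbits (subgrp G) {xs. length xs = n} map \<subseteq> (\<lambda>z. {y. tr G z y}) ` set zs"
    proof -
      have "{y. tr G x y} \<in> (\<lambda>z. {y. tr G z y}) ` set zs" if x: "length x = n" for x
      proof -
        obtain z where "z \<in> set zs" "tr G z x" using zs[OF x] by blast
        moreover have "{y. tr G x y} = {y. tr G z y}" using T \<open>tr G z x\<close> by blast
        ultimately show ?thesis by blast
      qed
      then show ?thesis unfolding eq by blast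
    qed
    then show "finite (orbits (subgrp G) {xs. length xs = n} map)"
      by (rule finite_subset) simp
  qed
  \<comment> \<open>\<open>finite_reps\<close> includes arity zero, which oligomorphicity leaves
    out; there the empty tuple is the only orbit.\<close>
  have "finite (orbits (subgrp G) {xs :: nat list. length xs = 0} map)"
    unfolding fin by (intro exI[of _ "[[]]"]) (auto simp: T)
  then show ?thesis
    unfolding finite_reps_def fin[symmetric] by (metis less_one linorder_not_less)
qed

locale oligo_group = closed_group +
  assumes finite_reps_tr: "finite_reps (tr G)"

lemma oligomorphic_groups_iff: "G \<in> oligomorphic_groups \<longleftrightarrow> oligo_group G"
proof (cases "closed_group G")
  case True
  then show ?thesis
    using closed_group.finite_orbits_iff[OF True]
    by (simp add: oligomorphic_groups_def oligo_group_def oligo_group_axioms_def closed_group_iff)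
qed (auto simp: oligomorphic_groups_def oligo_group_def closed_group_iff)

lemma oligo_group_pset: "orbit_system T \<Longrightarrow> finite_reps T \<Longrightarrow> oligo_group (pset T)"
  by (simp add: oligo_group_def oligo_group_axioms_def closed_group_pset tr_pset)

text \<open>A closed set equals \<open>pset\<close> of its trace, so being a group can be tested on
  the trace. In this form Borelness is a matter of countable quantifiers.\<close>

lemma oligomorphic_groups_eq:
  "oligomorphic_groups = {D. closedin S_inf_top D \<and> orbit_system (tr D) \<and> finite_reps (tr D)}"
proof (intro Set.set_eqI iffI CollectI)
  fix G assume "G \<in> oligomorphic_groups"
  then interpret oligo_group G by (simp add: oligomorphic_groups_iff)
  show "closedin S_inf_top G \<and> orbit_system (tr G) \<and> finite_reps (tr G)"
    using closed_group_iff closed_group_axioms orbit_system_tr finite_reps_tr by blast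
next
  fix G assume "G \<in> {D. closedin S_inf_top D \<and> orbit_system (tr D) \<and> finite_reps (tr D)}"
  then have G: "closedin S_inf_top G" "orbit_system (tr G)" "finite_reps (tr G)" by auto
  then have "pset (tr G) = G"
    unfolding closedin_S_inf_top by (auto simp: pset_def trI)
  then show "G \<in> oligomorphic_groups"
    using oligo_group_pset[OF G(2,3)] by (simp add: oligomorphic_groups_iff)
qed

section \<open>Open cosets\<close>

text \<open>Left and right cosets of open subgroups are the nonempty relatively open sets closed under
  \<open>(a, b, c) \<mapsto> a b\<^sup>-\<^sup>1 c\<close>; the tuple \<open>r\<close> witnesses openness uniformly.\<close>

definition open_coset :: "(nat \<Rightarrow> nat) set \<Rightarrow> (nat \<Rightarrow> nat) set \<Rightarrow> bool" where
  "open_coset G A \<longleftrightarrow> A \<subseteq> G \<and> A \<noteq> {} \<and> (\<forall>a\<in>A. \<forall>b\<in>A. \<forall>c\<in>A. a \<circ> pinv b \<circ> c \<in> A) \<and>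
     (\<exists>r. \<forall>a\<in>A. \<forall>g\<in>G. map g r = map a r \<longrightarrow> g \<in> A)"

definition prod_sub :: "(nat \<Rightarrow> nat) set \<Rightarrow> (nat \<Rightarrow> nat) set \<Rightarrow> (nat \<Rightarrow> nat) set \<Rightarrow> bool" where
  "prod_sub A B C \<longleftrightarrow> (\<forall>a\<in>A. \<forall>b\<in>B. a \<circ> b \<in> C)"

lemma open_coset_subset: "open_coset G A \<Longrightarrow> a \<in> A \<Longrightarrow> a \<in> G"
  and open_coset_nonempty: "open_coset G A \<Longrightarrow> A \<noteq> {}"
  and open_coset_triple: "open_coset G A \<Longrightarrow> a \<in> A \<Longrightarrow> b \<in> A \<Longrightarrow> c \<in> A \<Longrightarrow> a \<circ> pinv b \<circ> c \<in> A"
  by (auto simp: open_coset_def)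

lemma open_coset_open:
  assumes "open_coset G A"
  obtains r where "\<And>a g. a \<in> A \<Longrightarrow> g \<in> G \<Longrightarrow> map g r = map a r \<Longrightarrow> g \<in> A"
  using assms unfolding open_coset_def by blast

text \<open>A tuple travels from \<open>x\<close> by \<open>b\<close> to \<open>y\<close> and then
  by \<open>a\<close> to \<open>z\<close>. From right to left, \<open>a \<circ> b\<close> is
  approximated by \<open>C\<close> on every tuple, so closedness of \<open>C\<close> puts it into
  \<open>C\<close>. Quantifiers over permutations are thereby traded for quantifiers over
  tuples.\<close>

lemma prod_sub_iff_tr:
  assumes A: "A \<subseteq> {f. bij f}" and B: "B \<subseteq> {f. bij f}" and C: "pset (tr C) \<subseteq> C"
  shows "prod_sub A B C \<longleftrightarrow> (\<forall>x y z. tr A y z \<longrightarrow> tr B x y \<longrightarrow> tr C x z)"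
proof
  assume P: "prod_sub A B C"
  show "\<forall>x y z. tr A y z \<longrightarrow> tr B x y \<longrightarrow> tr C x z"
  proof (intro allI impI)
    fix x y z assume "tr A y z" "tr B x y"
    then obtain a b where "a \<in> A" "b \<in> B" "map a y = z" "map b x = y" by (auto simp: tr_def)
    then show "tr C x z" using P trI[of "a \<circ> b" C x] by (auto simp: prod_sub_def)
  qed
next
  assume R: "\<forall>x y z. tr A y z \<longrightarrow> tr B x y \<longrightarrow> tr C x z"
  show "prod_sub A B C"
    unfolding prod_sub_def
  proof (intro ballI)
    fix a b assume ab: "a \<in> A" "b \<in> B"
    have "tr C x (map (a \<circ> b) x)" for x
      using R trI[OF ab(1), of "map b x"] trI[OF ab(2), of x] by fastforce
    moreover have "bij (a \<circ> b)" using ab A B bij_comp by blast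
    ultimately show "a \<circ> b \<in> C" using C by (auto simp: pset_def)
  qed
qed

text \<open>The same exchange for \<open>a \<circ> pinv b \<circ> c\<close>: from \<open>x\<close>
  by \<open>c\<close> to \<open>y\<close>, back along \<open>b\<close> to \<open>z\<close>, and on
  by \<open>a\<close> to \<open>w\<close>.\<close>

lemma triple_iff_tr:
  assumes A: "A \<subseteq> {f. bij f}" and C: "pset (tr A) \<subseteq> A"
  shows "(\<forall>a\<in>A. \<forall>b\<in>A. \<forall>c\<in>A. a \<circ> pinv b \<circ> c \<in> A) \<longleftrightarrow>
    (\<forall>x y z w. tr A x y \<longrightarrow> tr A z y \<longrightarrow> tr A z w \<longrightarrow> tr A x w)"
proof
  assume P: "\<forall>a\<in>A. \<forall>b\<in>A. \<forall>c\<in>A. a \<circ> pinv b \<circ> c \<in> A"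
  show "\<forall>x y z w. tr A x y \<longrightarrow> tr A z y \<longrightarrow> tr A z w \<longrightarrow> tr A x w"
  proof (intro allI impI)
    fix x y z w assume "tr A x y" "tr A z y" "tr A z w"
    then obtain a b c where abc: "a \<in> A" "b \<in> A" "c \<in> A" "map c x = y" "map b z = y" "map a z = w"
      by (auto simp: tr_def)
    have "map (pinv b) y = z" using abc A map_eq_iff_map_pinv[of b z y] by auto
    then have "map (a \<circ> pinv b \<circ> c) x = w" using abc by (simp flip: map_map)
    then show "tr A x w" using P abc by (auto simp: tr_def)
  qed
next
  assume R: "\<forall>x y z w. tr A x y \<longrightarrow> tr A z y \<longrightarrow> tr A z w \<longrightarrow> tr A x w"
  show "\<forall>a\<in>A. \<forall>b\<in>A. \<forall>c\<in>A. a \<circ> pinv b \<circ> c \<in> A"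
  proof (intro ballI)
    fix a b c assume abc: "a \<in> A" "b \<in> A" "c \<in> A"
    then have bij: "bij a" "bij b" "bij c" using A by auto
    have "tr A x (map (a \<circ> pinv b \<circ> c) x)" for x
    proof -
      define z where "z = map (pinv b) (map c x)"
      have "map b z = map c x" using bij by (simp add: z_def pinv_comp_right fun.map_comp)
      then have "tr A x (map c x)" "tr A z (map c x)" "tr A z (map a z)"
        using trI abc by metis+
      then have "tr A x (map a z)" using R by blast
      then show ?thesis by (simp add: z_def o_assoc)
    qed
    moreover have "bij (a \<circ> pinv b \<circ> c)" using bij by (simp add: bij_comp bij_imp_bij_inv)
    ultimately show "a \<circ> pinv b \<circ> c \<in> A" using C by (auto simp: pset_def)
  qed
qed

context closed_group
begin

lemma map_eq_pinv_comp:
  "bij h \<Longrightarrow> map (pinv h \<circ> g) r = r \<longleftrightarrow> map g r = map h r"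
  by (metis map_eq_iff_map_pinv map_map)

text \<open>A witness of openness at one point \<open>a\<close> serves at every \<open>b\<close>: if
  \<open>g\<close> agrees with \<open>b\<close> on \<open>r\<close>, then
  \<open>a \<circ> pinv b \<circ> g\<close> agrees with \<open>a\<close> on \<open>r\<close>, and
  composing with \<open>b \<circ> pinv a\<close> brings it back to \<open>g\<close>.\<close>

lemma open_cosetI:
  assumes A: "A \<subseteq> G" "a \<in> A" and triple: "\<And>a b c. a \<in> A \<Longrightarrow> b \<in> A \<Longrightarrow> c \<in> A \<Longrightarrow> a \<circ> pinv b \<circ> c \<in> A"
    and nbhd: "\<And>g. g \<in> G \<Longrightarrow> map g r = map a r \<Longrightarrow> g \<in> A"
  shows "open_coset G A"
  unfolding open_coset_def
proof (intro conjI exI[of _ r] ballI impI)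
  fix b g assume b: "b \<in> A" and g: "g \<in> G" "map g r = map b r"
  have bij: "bij a" "bij b" "bij g" using A b g bij_mem by auto
  have "map (a \<circ> pinv b \<circ> g) r = map a (map (pinv b) (map b r))"
    using g(2) by (simp del: map_eq_conv flip: map_map)
  also have "\<dots> = map a r" using bij by (simp add: bij_is_inj)
  finally have "a \<circ> pinv b \<circ> g \<in> A" using A b g by (intro nbhd) (auto intro!: comp_mem inv_mem)
  then have "b \<circ> pinv a \<circ> (a \<circ> pinv b \<circ> g) \<in> A" using A b triple by blast
  moreover have "b \<circ> pinv a \<circ> (a \<circ> pinv b \<circ> g) = g" using bij by (simp add: fun_eq_iff)
  ultimately show "g \<in> A" by simp
qed (use assms in auto)

lemma open_coset_bij: "open_coset G A \<Longrightarrow> A \<subseteq> {f. bij f}"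
  using open_coset_subset bij_mem by blast

text \<open>A limit \<open>g\<close> of members of \<open>A\<close> lies in the closed group
  \<open>G\<close> and agrees with some member on \<open>r\<close>. Because \<open>r\<close> does
  not depend on that member, \<open>g\<close> is in \<open>A\<close>.\<close>

lemma closed_if_uniformly_open:
  assumes A: "A \<subseteq> G" and r: "\<And>a g. a \<in> A \<Longrightarrow> g \<in> G \<Longrightarrow> map g r = map a r \<Longrightarrow> g \<in> A"
  shows "pset (tr A) = A"
proof
  show "A \<subseteq> pset (tr A)" using A bij_mem by (auto simp: pset_def trI)
  show "pset (tr A) \<subseteq> A"
  proof
    fix g assume g: "g \<in> pset (tr A)"
    have "tr G x (map g x)" for x
      using g A unfolding pset_def tr_def by blast
    then have "g \<in> G" using closed_mem pset_bij[OF g] unfolding pset_def by blast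
    moreover obtain a where "a \<in> A" "map a r = map g r" using g by (auto simp: pset_def tr_def)
    ultimately show "g \<in> A" using r by metis
  qed
qed

lemma open_coset_closed:
  assumes "open_coset G A" shows "pset (tr A) = A"
proof -
  obtain r where r: "\<And>a g. a \<in> A \<Longrightarrow> g \<in> G \<Longrightarrow> map g r = map a r \<Longrightarrow> g \<in> A"
    using open_coset_open[OF assms] by metis
  have "A \<subseteq> G" using open_coset_subset[OF assms] by (rule subsetI)
  then show ?thesis by (rule closed_if_uniformly_open) (rule r)
qed

text \<open>These are the left cosets of the stabiliser of \<open>x\<close>, the basic open sets of
  \<open>G\<close>.\<close>

lemma open_coset_mapsto:
  assumes "tr G x y"
  shows "open_coset G {g\<in>G. map g x = y}"
proof -
  obtain a where a: "a \<in> G" "map a x = y" using assms by (auto simp: tr_def)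
  show ?thesis
  proof (rule open_cosetI[where a = a and r = x])
    fix a b c assume abc: "a \<in> {g\<in>G. map g x = y}" "b \<in> {g\<in>G. map g x = y}" "c \<in> {g\<in>G. map g x = y}"
    then have "map (pinv b) y = x" using map_eq_iff_map_pinv[of b x y] bij_mem by auto
    then have "map (a \<circ> pinv b \<circ> c) x = y" using abc by (simp flip: map_map)
    then show "a \<circ> pinv b \<circ> c \<in> {g\<in>G. map g x = y}" using abc by (auto intro!: comp_mem inv_mem)
  qed (use a in auto)
qed

lemma open_coset_left:
  assumes A: "open_coset G A" and g: "g \<in> G"
  shows "open_coset G ((\<circ>) g ` A)"
proof -
  obtain r where r: "\<And>a g. a \<in> A \<Longrightarrow> g \<in> G \<Longrightarrow> map g r = map a r \<Longrightarrow> g \<in> A"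
    using open_coset_open[OF A] by metis
  obtain a where a: "a \<in> A" using open_coset_nonempty[OF A] by blast
  have bg: "bij g" using g bij_mem by blast
  show ?thesis
  proof (rule open_cosetI[where a = "g \<circ> a" and r = r])
    show "(\<circ>) g ` A \<subseteq> G" using open_coset_subset[OF A] comp_mem g by auto
    show "g \<circ> a \<in> (\<circ>) g ` A" using a by auto
    fix h assume h: "h \<in> G" "map h r = map (g \<circ> a) r"
    have "map (pinv g \<circ> h) r = map (pinv g) (map g (map a r))" using h(2) by (simp flip: map_map)
    also have "\<dots> = map a r" using bg by (simp add: fun.map_comp bij_is_inj)
    finally have "pinv g \<circ> h \<in> A" using r[OF a] comp_mem inv_mem g h(1) by blast
    moreover have "h = g \<circ> (pinv g \<circ> h)" using bg by (simp add: fun_eq_iff)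
    ultimately show "h \<in> (\<circ>) g ` A" by blast
  next
    fix u v w assume "u \<in> (\<circ>) g ` A" "v \<in> (\<circ>) g ` A" "w \<in> (\<circ>) g ` A"
    then obtain a b c where abc: "a \<in> A" "b \<in> A" "c \<in> A" "u = g \<circ> a" "v = g \<circ> b" "w = g \<circ> c" by blast
    have bb: "bij b" using abc(2) open_coset_bij[OF A] by blast
    have "u \<circ> pinv v \<circ> w = g \<circ> (a \<circ> pinv b \<circ> c)"
      unfolding abc(4-) o_inv_distrib[OF bg bb] using bg by (simp add: fun_eq_iff)
    then show "u \<circ> pinv v \<circ> w \<in> (\<circ>) g ` A" using open_coset_triple[OF A abc(1-3)] by blast
  qed
qed

lemma open_coset_right:
  assumes A: "open_coset G A" and g: "g \<in> G"
  shows "open_coset G ((\<lambda>a. a \<circ> g) ` A)"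
proof -
  obtain r where r: "\<And>a g. a \<in> A \<Longrightarrow> g \<in> G \<Longrightarrow> map g r = map a r \<Longrightarrow> g \<in> A"
    using open_coset_open[OF A] by metis
  obtain a where a: "a \<in> A" using open_coset_nonempty[OF A] by blast
  have bg: "bij g" using g bij_mem by blast
  show ?thesis
  \<comment> \<open>Agreeing with \<open>a \<circ> g\<close> on this tuple is the same for
    \<open>h\<close> as agreeing with \<open>a\<close> on \<open>r\<close> for
    \<open>h \<circ> pinv g\<close>.\<close>
  proof (rule open_cosetI[where a = "a \<circ> g" and r = "map (pinv g) r"])
    show "(\<lambda>a. a \<circ> g) ` A \<subseteq> G" using open_coset_subset[OF A] comp_mem g by auto
    show "a \<circ> g \<in> (\<lambda>a. a \<circ> g) ` A" using a by auto
    fix h assume h: "h \<in> G" "map h (map (pinv g) r) = map (a \<circ> g) (map (pinv g) r)"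
    have "map (h \<circ> pinv g) r = map a (map (g \<circ> pinv g) r)" using h(2) by (simp add: o_assoc)
    also have "\<dots> = map a r" using bg by (simp add: pinv_comp_right)
    finally have "h \<circ> pinv g \<in> A" using r[OF a] comp_mem inv_mem g h(1) by blast
    moreover have "h = (h \<circ> pinv g) \<circ> g" using bg by (simp add: fun_eq_iff)
    ultimately show "h \<in> (\<lambda>a. a \<circ> g) ` A" by blast
  next
    fix u v w assume "u \<in> (\<lambda>a. a \<circ> g) ` A" "v \<in> (\<lambda>a. a \<circ> g) ` A" "w \<in> (\<lambda>a. a \<circ> g) ` A"
    then obtain a b c where abc: "a \<in> A" "b \<in> A" "c \<in> A" "u = a \<circ> g" "v = b \<circ> g" "w = c \<circ> g" by blast
    have bb: "bij b" using abc(2) open_coset_bij[OF A] by blast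
    have "u \<circ> pinv v \<circ> w = (a \<circ> pinv b \<circ> c) \<circ> g"
      unfolding abc(4-) o_inv_distrib[OF bb bg] using bg by (simp add: fun_eq_iff)
    then show "u \<circ> pinv v \<circ> w \<in> (\<lambda>a. a \<circ> g) ` A" using open_coset_triple[OF A abc(1-3)] by blast
  qed
qed

lemma open_coset_Int:
  assumes A: "open_coset G A" and B: "open_coset G B" and g: "g \<in> A" "g \<in> B"
  shows "open_coset G (A \<inter> B)"
proof -
  obtain r where r: "\<And>a g. a \<in> A \<Longrightarrow> g \<in> G \<Longrightarrow> map g r = map a r \<Longrightarrow> g \<in> A"
    using open_coset_open[OF A] by metis
  obtain s where s: "\<And>a g. a \<in> B \<Longrightarrow> g \<in> G \<Longrightarrow> map g s = map a s \<Longrightarrow> g \<in> B"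
    using open_coset_open[OF B] by metis
  show ?thesis
  proof (rule open_cosetI[where a = g and r = "r @ s"])
    show "h \<in> A \<inter> B" if "h \<in> G" "map h (r @ s) = map g (r @ s)" for h
      using that r[OF g(1)] s[OF g(2)] by auto
  qed (use g open_coset_subset[OF A] open_coset_triple[OF A] open_coset_triple[OF B] in auto)
qed

lemma open_coset_self: "open_coset G G"
  by (rule open_cosetI[where a = id and r = "[]"]) (auto intro!: comp_mem inv_mem id_mem)

end

section \<open>Topological isomorphisms\<close>

text \<open>Continuity of a homomorphism and of its inverse, in the form of uniform continuity.\<close>

definition tgi :: "(nat \<Rightarrow> nat) set \<Rightarrow> (nat \<Rightarrow> nat) set \<Rightarrow> ((nat \<Rightarrow> nat) \<Rightarrow> nat \<Rightarrow> nat) \<Rightarrow> bool" where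
  "tgi G H \<phi> \<longleftrightarrow> bij_betw \<phi> G H \<and> (\<forall>g\<in>G. \<forall>h\<in>G. \<phi> (g \<circ> h) = \<phi> g \<circ> \<phi> h) \<and>
     (\<forall>y. \<exists>x. \<forall>g\<in>G. \<forall>h\<in>G. map g x = map h x \<longrightarrow> map (\<phi> g) y = map (\<phi> h) y) \<and>
     (\<forall>x. \<exists>y. \<forall>g\<in>G. \<forall>h\<in>G. map (\<phi> g) y = map (\<phi> h) y \<longrightarrow> map g x = map h x)"

lemma
  assumes "tgi G H \<phi>"
  shows tgi_bij: "bij_betw \<phi> G H"
    and tgi_hom: "g \<in> G \<Longrightarrow> h \<in> G \<Longrightarrow> \<phi> (g \<circ> h) = \<phi> g \<circ> \<phi> h"
    and tgi_cont: "\<exists>x. \<forall>g\<in>G. \<forall>h\<in>G. map g x = map h x \<longrightarrow> map (\<phi> g) y = map (\<phi> h) y"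
    and tgi_cont_inv: "\<exists>y. \<forall>g\<in>G. \<forall>h\<in>G. map (\<phi> g) y = map (\<phi> h) y \<longrightarrow> map g x = map h x"
    and tgi_mem: "g \<in> G \<Longrightarrow> \<phi> g \<in> H"
  using assms by (auto simp: tgi_def bij_betw_apply)

lemma tgi_refl: "tgi G G id"
  by (auto simp: tgi_def)

lemma tgi_sym:
  assumes "tgi G H \<phi>" and "closed_group G"
  shows "tgi H G (inv_into G \<phi>)"
proof -
  interpret closed_group G by fact
  define \<psi> where "\<psi> = inv_into G \<phi>"
  note bij = tgi_bij[OF assms(1)]
  have \<psi>: "h \<in> H \<Longrightarrow> \<psi> h \<in> G" "h \<in> H \<Longrightarrow> \<phi> (\<psi> h) = h" "g \<in> G \<Longrightarrow> \<psi> (\<phi> g) = g" for g h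
    using bij by (auto simp: \<psi>_def bij_betw_inv_into_left bij_betw_inv_into_right
        intro: bij_betw_apply[OF bij_betw_inv_into])
  have "\<psi> (g \<circ> h) = \<psi> g \<circ> \<psi> h" if "g \<in> H" "h \<in> H" for g h
    using tgi_hom[OF assms(1), of "\<psi> g" "\<psi> h"] \<psi> that comp_mem by metis
  moreover have "\<exists>x. \<forall>g\<in>H. \<forall>h\<in>H. map g x = map h x \<longrightarrow> map (\<psi> g) y = map (\<psi> h) y" for y
    using tgi_cont_inv[OF assms(1), of y] \<psi> by metis
  moreover have "\<exists>y. \<forall>g\<in>H. \<forall>h\<in>H. map (\<psi> g) y = map (\<psi> h) y \<longrightarrow> map g x = map h x" for x
    using tgi_cont[OF assms(1), of x] \<psi> by metis
  ultimately show ?thesis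
    using bij_betw_inv_into[OF bij] unfolding tgi_def \<psi>_def by blast
qed

lemma tgi_trans:
  assumes \<phi>: "tgi G H \<phi>" and \<psi>: "tgi H K \<psi>"
  shows "tgi G K (\<psi> \<circ> \<phi>)"
proof -
  note mem = tgi_mem[OF \<phi>]
  have "(\<psi> \<circ> \<phi>) (g \<circ> h) = (\<psi> \<circ> \<phi>) g \<circ> (\<psi> \<circ> \<phi>) h" if "g \<in> G" "h \<in> G" for g h
    using that mem by (simp add: tgi_hom[OF \<phi>] tgi_hom[OF \<psi>])
  moreover have "\<exists>x. \<forall>g\<in>G. \<forall>h\<in>G. map g x = map h x \<longrightarrow> map ((\<psi> \<circ> \<phi>) g) z = map ((\<psi> \<circ> \<phi>) h) z" for z
  proof -
    obtain y where y: "\<forall>g\<in>H. \<forall>h\<in>H. map g y = map h y \<longrightarrow> map (\<psi> g) z = map (\<psi> h) z"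
      using tgi_cont[OF \<psi>] by blast
    obtain x where "\<forall>g\<in>G. \<forall>h\<in>G. map g x = map h x \<longrightarrow> map (\<phi> g) y = map (\<phi> h) y"
      using tgi_cont[OF \<phi>] by blast
    then show ?thesis using y mem unfolding o_apply by meson
  qed
  moreover have "\<exists>z. \<forall>g\<in>G. \<forall>h\<in>G. map ((\<psi> \<circ> \<phi>) g) z = map ((\<psi> \<circ> \<phi>) h) z \<longrightarrow> map g x = map h x" for x
  proof -
    obtain y where y: "\<forall>g\<in>G. \<forall>h\<in>G. map (\<phi> g) y = map (\<phi> h) y \<longrightarrow> map g x = map h x"
      using tgi_cont_inv[OF \<phi>] by blast
    obtain z where "\<forall>g\<in>H. \<forall>h\<in>H. map (\<psi> g) z = map (\<psi> h) z \<longrightarrow> map g y = map h y"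
      using tgi_cont_inv[OF \<psi>] by blast
    then show ?thesis using y mem unfolding o_apply by meson
  qed
  ultimately show ?thesis
    using bij_betw_trans[OF tgi_bij[OF \<phi>] tgi_bij[OF \<psi>]] unfolding tgi_def by blast
qed

lemma openin_subtopology_S_inf_top:
  assumes "closed_group G"
  shows "openin (subtopology S_inf_top G) U \<longleftrightarrow>
    U \<subseteq> G \<and> (\<forall>g\<in>U. \<exists>x. \<forall>h\<in>G. map h x = map g x \<longrightarrow> h \<in> U)"
proof
  interpret closed_group G by fact
  {
    assume "openin (subtopology S_inf_top G) U"
    then obtain W where W: "openin S_inf_top W" "U = W \<inter> G" by (auto simp: openin_subtopology)
    have "\<exists>x. \<forall>h\<in>G. map h x = map g x \<longrightarrow> h \<in> U" if g: "g \<in> U" for g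
    proof -
      have "g \<in> W" using W g by blast
      then obtain x where "\<forall>h. bij h \<longrightarrow> map h x = map g x \<longrightarrow> h \<in> W"
        using W(1) unfolding openin_S_inf_top by blast
      then show ?thesis using W(2) bij_mem by (intro exI[of _ x]) auto
    qed
    then show "U \<subseteq> G \<and> (\<forall>g\<in>U. \<exists>x. \<forall>h\<in>G. map h x = map g x \<longrightarrow> h \<in> U)" using W by blast
  next
    assume R: "U \<subseteq> G \<and> (\<forall>g\<in>U. \<exists>x. \<forall>h\<in>G. map h x = map g x \<longrightarrow> h \<in> U)"
    then obtain x where x: "\<And>g h. g \<in> U \<Longrightarrow> h \<in> G \<Longrightarrow> map h (x g) = map g (x g) \<Longrightarrow> h \<in> U"
      by metis
    define W where "W = {h. bij h \<and> (\<exists>g\<in>U. map h (x g) = map g (x g))}"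
    have "openin S_inf_top W"
      unfolding openin_S_inf_top
    proof (intro conjI ballI)
      fix h assume "h \<in> W"
      then obtain g where "g \<in> U" "map h (x g) = map g (x g)" by (auto simp: W_def)
      then show "\<exists>y. \<forall>k. bij k \<longrightarrow> map k y = map h y \<longrightarrow> k \<in> W"
        by (intro exI[of _ "x g"]) (auto simp: W_def simp del: map_eq_conv)
    qed (auto simp: W_def)
    moreover have "U = W \<inter> G"
    proof
      show "U \<subseteq> W \<inter> G" using R bij_mem by (auto simp: W_def)
      show "W \<inter> G \<subseteq> U" unfolding W_def using x by blast
    qed
    ultimately show "openin (subtopology S_inf_top G) U" by (auto simp: openin_subtopology)
  }
qed

lemma topspace_subtopology_S_inf_top:
  assumes "closed_group G" shows "topspace (subtopology S_inf_top G) = G"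
  using closed_group_bij[OF assms] by (auto simp: topspace_S_inf_top)

lemma iso_subgrp:
  assumes G: "closed_group G" and H: "closed_group H"
  shows "\<phi> \<in> iso (subgrp G) (subgrp H) \<longleftrightarrow>
    bij_betw \<phi> G H \<and> (\<forall>g\<in>G. \<forall>h\<in>G. \<phi> (g \<circ> h) = \<phi> g \<circ> \<phi> h)"
proof -
  have "(\<phi> (g \<otimes>\<^bsub>S_inf\<^esub> h) = \<phi> g \<otimes>\<^bsub>S_inf\<^esub> \<phi> h) \<longleftrightarrow> (\<phi> (g \<circ> h) = \<phi> g \<circ> \<phi> h)"
    if "g \<in> G" "h \<in> G" "\<phi> \<in> G \<rightarrow> H" for g h
  proof -
    have "bij g" "bij h" "bij (\<phi> g)" "bij (\<phi> h)"
      using that closed_group_bij[OF G] closed_group_bij[OF H] by auto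
    then show ?thesis by (simp add: mult_S_inf)
  qed
  then show ?thesis
    by (auto simp: iso_def hom_def subgrp_def bij_betw_apply Pi_def)
qed

text \<open>Continuity at the identity already gives a tuple \<open>x\<close> for each
  \<open>y\<close>; translation makes the same \<open>x\<close> work at every point, since
  permutations \<open>g\<close> and \<open>h\<close> agree on \<open>x\<close> exactly when
  \<open>pinv h \<circ> g\<close> fixes it.\<close>

lemma continuous_hom_S_inf:
  assumes G: "closed_group G" and H: "closed_group H"
    and hom: "\<And>g h. g \<in> G \<Longrightarrow> h \<in> G \<Longrightarrow> \<phi> (g \<circ> h) = \<phi> g \<circ> \<phi> h"
    and mem: "\<And>g. g \<in> G \<Longrightarrow> \<phi> g \<in> H"
  shows "continuous_map (subtopology S_inf_top G) (subtopology S_inf_top H) \<phi> \<longleftrightarrow>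
    (\<forall>y. \<exists>x. \<forall>g\<in>G. \<forall>h\<in>G. map g x = map h x \<longrightarrow> map (\<phi> g) y = map (\<phi> h) y)"
proof
  interpret G: closed_group G by fact
  interpret H: closed_group H by fact
  {
    assume C: "continuous_map (subtopology S_inf_top G) (subtopology S_inf_top H) \<phi>"
    show "\<forall>y. \<exists>x. \<forall>g\<in>G. \<forall>h\<in>G. map g x = map h x \<longrightarrow> map (\<phi> g) y = map (\<phi> h) y"
    proof
      fix y
      have "openin (subtopology S_inf_top H) {h\<in>H. map h y = map (\<phi> id) y}"
        unfolding openin_subtopology_S_inf_top[OF H]
        by (auto intro!: exI[of _ y] simp del: map_eq_conv)
      then have "openin (subtopology S_inf_top G) {g\<in>G. \<phi> g \<in> {h\<in>H. map h y = map (\<phi> id) y}}"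
        using C unfolding continuous_map_def topspace_subtopology_S_inf_top[OF G] by blast
      moreover have "id \<in> {g\<in>G. \<phi> g \<in> {h\<in>H. map h y = map (\<phi> id) y}}"
        using mem G.id_mem by auto
      ultimately obtain x where
        "\<forall>h\<in>G. map h x = map id x \<longrightarrow> h \<in> {g\<in>G. \<phi> g \<in> {h\<in>H. map h y = map (\<phi> id) y}}"
        unfolding openin_subtopology_S_inf_top[OF G] by blast
      then have x: "map (\<phi> k) y = map (\<phi> id) y" if "k \<in> G" "map k x = x" for k
        using that by auto
      show "\<exists>x. \<forall>g\<in>G. \<forall>h\<in>G. map g x = map h x \<longrightarrow> map (\<phi> g) y = map (\<phi> h) y"
      proof (intro exI[of _ x] ballI impI)
        fix g h assume gh: "g \<in> G" "h \<in> G" "map g x = map h x"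
        let ?k = "pinv h \<circ> g"
        have k: "?k \<in> G" "map ?k x = x"
          using gh G.comp_mem G.inv_mem G.map_eq_pinv_comp G.bij_mem by auto
        have "map (\<phi> g) y = map (\<phi> (h \<circ> ?k)) y"
          using G.bij_mem[OF gh(2)] by (simp add: o_assoc pinv_comp_right)
        also have "\<dots> = map (\<phi> h) (map (\<phi> ?k) y)" using hom[OF gh(2) k(1)] by simp
        also have "\<dots> = map (\<phi> h) (map (\<phi> id) y)" using x[OF k] by simp
        also have "\<dots> = map (\<phi> (h \<circ> id)) y" using hom[OF gh(2) G.id_mem] by simp
        finally show "map (\<phi> g) y = map (\<phi> h) y" by simp
      qed
    qed
  next
    assume R: "\<forall>y. \<exists>x. \<forall>g\<in>G. \<forall>h\<in>G. map g x = map h x \<longrightarrow> map (\<phi> g) y = map (\<phi> h) y"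
    show "continuous_map (subtopology S_inf_top G) (subtopology S_inf_top H) \<phi>"
      unfolding continuous_map_def topspace_subtopology_S_inf_top[OF G] topspace_subtopology_S_inf_top[OF H]
    proof (intro conjI allI impI)
      fix U assume "openin (subtopology S_inf_top H) U"
      then have U: "\<And>g. g \<in> U \<Longrightarrow> \<exists>y. \<forall>h\<in>H. map h y = map g y \<longrightarrow> h \<in> U"
        unfolding openin_subtopology_S_inf_top[OF H] by blast
      show "openin (subtopology S_inf_top G) {g\<in>G. \<phi> g \<in> U}"
        unfolding openin_subtopology_S_inf_top[OF G]
      proof (intro conjI ballI)
        fix g assume g: "g \<in> {g\<in>G. \<phi> g \<in> U}"
        then obtain y where y: "\<forall>h\<in>H. map h y = map (\<phi> g) y \<longrightarrow> h \<in> U" using U by blast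
        obtain x where x: "\<forall>g\<in>G. \<forall>h\<in>G. map g x = map h x \<longrightarrow> map (\<phi> g) y = map (\<phi> h) y"
          using R by blast
        have "k \<in> {g\<in>G. \<phi> g \<in> U}" if k: "k \<in> G" "map k x = map g x" for k
        proof -
          have "map (\<phi> k) y = map (\<phi> g) y" using x k g by blast
          then show ?thesis using y mem k(1) by blast
        qed
        then show "\<exists>x. \<forall>h\<in>G. map h x = map g x \<longrightarrow> h \<in> {g\<in>G. \<phi> g \<in> U}" by blast
      qed blast
    qed (use mem in auto)
  }
qed

text \<open>The inverse supplied by a homeomorphism must coincide on \<open>H\<close> with
  \<open>inv_into G \<phi>\<close>, which is again a homomorphism. Continuity of both maps then
  becomes uniform continuity, and the condition on the inverse is rewritten over
  \<open>G\<close>.\<close>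

lemma top_group_iso_iff:
  assumes G: "closed_group G" and H: "closed_group H"
  shows "top_group_iso G H \<longleftrightarrow> (\<exists>\<phi>. tgi G H \<phi>)"
proof -
  interpret G: closed_group G by fact
  interpret H: closed_group H by fact
  have "homeomorphic_map (subtopology S_inf_top G) (subtopology S_inf_top H) \<phi> \<longleftrightarrow> tgi G H \<phi>"
    if bij: "bij_betw \<phi> G H" and hom: "\<forall>g\<in>G. \<forall>h\<in>G. \<phi> (g \<circ> h) = \<phi> g \<circ> \<phi> h" for \<phi>
  proof -
    define \<psi> where "\<psi> = inv_into G \<phi>"
    have \<phi>: "g \<in> G \<Longrightarrow> \<phi> g \<in> H" for g using bij by (rule bij_betw_apply)
    have \<psi>: "h \<in> H \<Longrightarrow> \<psi> h \<in> G" "h \<in> H \<Longrightarrow> \<phi> (\<psi> h) = h" "g \<in> G \<Longrightarrow> \<psi> (\<phi> g) = g" for g h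
      using bij by (auto simp: \<psi>_def bij_betw_inv_into_left bij_betw_inv_into_right
          intro: bij_betw_apply[OF bij_betw_inv_into])
    have hom': "\<psi> (g \<circ> h) = \<psi> g \<circ> \<psi> h" if "g \<in> H" "h \<in> H" for g h
      using hom \<psi> that G.comp_mem by metis
    have "homeomorphic_map (subtopology S_inf_top G) (subtopology S_inf_top H) \<phi> \<longleftrightarrow>
        homeomorphic_maps (subtopology S_inf_top G) (subtopology S_inf_top H) \<phi> \<psi>"
    proof
      assume "homeomorphic_map (subtopology S_inf_top G) (subtopology S_inf_top H) \<phi>"
      then obtain \<psi>' where h: "homeomorphic_maps (subtopology S_inf_top G) (subtopology S_inf_top H) \<phi> \<psi>'"
        using homeomorphic_map_maps by blast
      have "\<psi>' h = \<psi> h" if "h \<in> H" for h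
        using h \<psi>(1,2)[OF that] that
        unfolding homeomorphic_maps_def topspace_subtopology_S_inf_top[OF G] topspace_subtopology_S_inf_top[OF H]
        by metis
      then show "homeomorphic_maps (subtopology S_inf_top G) (subtopology S_inf_top H) \<phi> \<psi>"
        using h by (intro homeomorphic_maps_eq[OF h])
          (auto simp: topspace_subtopology_S_inf_top[OF G] topspace_subtopology_S_inf_top[OF H]
            simp del: topspace_subtopology)
    qed (use homeomorphic_map_maps in blast)
    also have "\<dots> \<longleftrightarrow> (\<forall>y. \<exists>x. \<forall>g\<in>G. \<forall>h\<in>G. map g x = map h x \<longrightarrow> map (\<phi> g) y = map (\<phi> h) y) \<and>
        (\<forall>y. \<exists>x. \<forall>g\<in>H. \<forall>h\<in>H. map g x = map h x \<longrightarrow> map (\<psi> g) y = map (\<psi> h) y)"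
    proof -
      have "continuous_map (subtopology S_inf_top G) (subtopology S_inf_top H) \<phi> \<longleftrightarrow>
          (\<forall>y. \<exists>x. \<forall>g\<in>G. \<forall>h\<in>G. map g x = map h x \<longrightarrow> map (\<phi> g) y = map (\<phi> h) y)"
        using hom \<phi> by (intro continuous_hom_S_inf[OF G H]) auto
      moreover have "continuous_map (subtopology S_inf_top H) (subtopology S_inf_top G) \<psi> \<longleftrightarrow>
          (\<forall>y. \<exists>x. \<forall>g\<in>H. \<forall>h\<in>H. map g x = map h x \<longrightarrow> map (\<psi> g) y = map (\<psi> h) y)"
        using hom' \<psi>(1) by (intro continuous_hom_S_inf[OF H G]) auto
      ultimately show ?thesis
        unfolding homeomorphic_maps_def topspace_subtopology_S_inf_top[OF G] topspace_subtopology_S_inf_top[OF H]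
        using \<psi> by simp
    qed
    also have "(\<forall>y. \<exists>x. \<forall>g\<in>H. \<forall>h\<in>H. map g x = map h x \<longrightarrow> map (\<psi> g) y = map (\<psi> h) y) \<longleftrightarrow>
       (\<forall>x. \<exists>y. \<forall>g\<in>G. \<forall>h\<in>G. map (\<phi> g) y = map (\<phi> h) y \<longrightarrow> map g x = map h x)"
    proof (intro all_cong1 ex_cong1)
      have H_eq: "H = \<phi> ` G" using bij by (auto simp: bij_betw_def)
      show "(\<forall>g\<in>H. \<forall>h\<in>H. map g x = map h x \<longrightarrow> map (\<psi> g) y = map (\<psi> h) y) \<longleftrightarrow>
        (\<forall>g\<in>G. \<forall>h\<in>G. map (\<phi> g) x = map (\<phi> h) x \<longrightarrow> map g y = map h y)" for x y
        unfolding H_eq by (simp add: \<psi>(3) del: map_eq_conv)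
    qed
    finally show ?thesis using bij hom unfolding tgi_def by blast
  qed
  then show ?thesis
    unfolding top_group_iso_def iso_subgrp[OF G H] Bex_def using tgi_bij tgi_hom
    unfolding iso_subgrp[OF G H] by blast
qed

lemma
  assumes "closed_group G" and bij: "\<And>g. g \<in> G \<Longrightarrow> bij (\<phi> g)"
    and hom: "\<And>g h. g \<in> G \<Longrightarrow> h \<in> G \<Longrightarrow> \<phi> (g \<circ> h) = \<phi> g \<circ> \<phi> h"
  shows hom_id: "\<phi> id = id" and hom_pinv: "g \<in> G \<Longrightarrow> \<phi> (pinv g) = pinv (\<phi> g)"
proof -
  interpret closed_group G by fact
  have "\<phi> id \<circ> \<phi> id = \<phi> id" using hom[OF id_mem id_mem] by simp
  then have "pinv (\<phi> id) \<circ> (\<phi> id \<circ> \<phi> id) = pinv (\<phi> id) \<circ> \<phi> id" by simp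
  then show 1: "\<phi> id = id"
    using pinv_comp_left[OF bij[OF id_mem]] by (simp add: o_assoc)
  show "\<phi> (pinv g) = pinv (\<phi> g)" if g: "g \<in> G"
  proof -
    have "\<phi> (pinv g) \<circ> \<phi> g = id"
      using hom[OF inv_mem[OF g] g] 1 pinv_comp_left[OF bij_mem[OF g]] by simp
    then show ?thesis
      using bij[OF g] by (metis comp_assoc id_comp comp_id pinv_comp_right)
  qed
qed

lemma tgi_pinv:
  assumes "tgi G H \<phi>" "closed_group G" "closed_group H" "g \<in> G"
  shows "\<phi> (pinv g) = pinv (\<phi> g)"
  using hom_pinv[of G \<phi> g] assms tgi_hom[OF assms(1)] tgi_mem[OF assms(1)] closed_group_bij[of H]
  by blast

text \<open>Openness of the image is where continuity of the inverse enters: agreement of images on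
  \<open>y\<close> forces agreement on the tuple \<open>r\<close> that witnesses openness of
  \<open>A\<close>.\<close>

lemma open_coset_image:
  assumes \<phi>: "tgi G H \<phi>" and G: "closed_group G" and H: "closed_group H" and A: "open_coset G A"
  shows "open_coset H (\<phi> ` A)"
proof -
  interpret closed_group G by fact
  note AG = open_coset_subset[OF A]
  obtain r where r: "\<And>a g. a \<in> A \<Longrightarrow> g \<in> G \<Longrightarrow> map g r = map a r \<Longrightarrow> g \<in> A"
    using open_coset_open[OF A] by metis
  obtain y where y: "\<forall>g\<in>G. \<forall>h\<in>G. map (\<phi> g) y = map (\<phi> h) y \<longrightarrow> map g r = map h r"
    using tgi_cont_inv[OF \<phi>] by blast
  show ?thesis
    unfolding open_coset_def
  proof (intro conjI ballI exI[of _ y] impI)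
    show "\<phi> ` A \<subseteq> H" using AG tgi_mem[OF \<phi>] by blast
    show "\<phi> ` A \<noteq> {}" using open_coset_nonempty[OF A] by blast
    show "h \<in> \<phi> ` A" if u: "u \<in> \<phi> ` A" and h: "h \<in> H" "map h y = map u y" for u h
    proof -
      obtain a where a: "a \<in> A" "u = \<phi> a" using u by blast
      obtain g where g: "g \<in> G" "h = \<phi> g" using h(1) tgi_bij[OF \<phi>] by (auto simp: bij_betw_def)
      have "map g r = map a r" using y g a AG h(2) by blast
      then show ?thesis using r a g by blast
    qed
    show "u \<circ> pinv v \<circ> w \<in> \<phi> ` A" if uvw: "u \<in> \<phi> ` A" "v \<in> \<phi> ` A" "w \<in> \<phi> ` A" for u v w
    proof -
      obtain a b c where abc: "a \<in> A" "b \<in> A" "c \<in> A" "u = \<phi> a" "v = \<phi> b" "w = \<phi> c" using uvw by blast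
      then have m: "a \<in> G" "pinv b \<in> G" "c \<in> G" "b \<in> G" using AG inv_mem by auto
      have "u \<circ> pinv v \<circ> w = \<phi> (a \<circ> pinv b \<circ> c)"
        unfolding abc(4-) by (simp add: tgi_hom[OF \<phi>] m comp_mem tgi_pinv[OF \<phi> G H])
      then show ?thesis using open_coset_triple[OF A abc(1-3)] by blast
    qed
  qed
qed

lemma prod_sub_image:
  assumes \<phi>: "tgi G H \<phi>" and G: "closed_group G" and "A \<subseteq> G" "B \<subseteq> G" "C \<subseteq> G"
  shows "prod_sub (\<phi> ` A) (\<phi> ` B) (\<phi> ` C) \<longleftrightarrow> prod_sub A B C"
proof -
  interpret closed_group G by fact
  have "\<phi> a \<circ> \<phi> b \<in> \<phi> ` C \<longleftrightarrow> a \<circ> b \<in> C" if ab: "a \<in> A" "b \<in> B" for a b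
  proof -
    have m: "a \<in> G" "b \<in> G" "a \<circ> b \<in> G" using ab assms(3,4) comp_mem by auto
    then have "\<phi> a \<circ> \<phi> b = \<phi> (a \<circ> b)" by (simp add: tgi_hom[OF \<phi>])
    then show ?thesis
      using m assms(5) tgi_bij[OF \<phi>] inj_on_image_mem_iff[of \<phi> G "a \<circ> b" C]
      by (simp add: bij_betw_def)
  qed
  then show ?thesis by (simp add: prod_sub_def)
qed

lemma bij_betw_open_cosets:
  assumes \<phi>: "tgi G H \<phi>" and G: "closed_group G" and H: "closed_group H"
  shows "bij_betw ((`) \<phi>) {A. open_coset G A} {A. open_coset H A}"
  unfolding bij_betw_def
proof
  have inj: "inj_on \<phi> G" using tgi_bij[OF \<phi>] by (simp add: bij_betw_def)
  show "inj_on ((`) \<phi>) {A. open_coset G A}"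
  proof (rule inj_onI)
    fix A B assume AB: "A \<in> {A. open_coset G A}" "B \<in> {A. open_coset G A}" "\<phi> ` A = \<phi> ` B"
    then have "A \<subseteq> G" "B \<subseteq> G" using open_coset_subset by blast+
    then show "A = B" using inj_on_image_eq_iff[OF inj] AB(3) by blast
  qed
  show "(`) \<phi> ` {A. open_coset G A} = {A. open_coset H A}"
  proof
    show "(`) \<phi> ` {A. open_coset G A} \<subseteq> {A. open_coset H A}"
      using open_coset_image[OF \<phi> G H] by blast
    show "{A. open_coset H A} \<subseteq> (`) \<phi> ` {A. open_coset G A}"
    proof
      fix B assume "B \<in> {A. open_coset H A}"
      then have B: "open_coset H B" by simp
      then have "open_coset G (inv_into G \<phi> ` B)"
        using open_coset_image[OF tgi_sym[OF \<phi> G] H G] by blast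
      moreover have "\<phi> ` (inv_into G \<phi> ` B) = B"
        using open_coset_subset[OF B] tgi_bij[OF \<phi>]
        by (intro image_inv_into_cancel[of \<phi> G H]) (auto simp: bij_betw_def)
      ultimately show "B \<in> (`) \<phi> ` {A. open_coset G A}" by blast
    qed
  qed
qed

section \<open>Groups presented by ternary relations\<close>

definition presents ::
  "(nat \<Rightarrow> nat \<Rightarrow> nat \<Rightarrow> bool) \<Rightarrow> (nat \<Rightarrow> nat) set \<Rightarrow> (nat \<Rightarrow> (nat \<Rightarrow> nat) set) \<Rightarrow> bool" where
  "presents R G F \<longleftrightarrow> bij_betw F UNIV {A. open_coset G A} \<and>
     (\<forall>a b c. R a b c \<longleftrightarrow> prod_sub (F a) (F b) (F c))"

lemma presents_tgi_iso:
  assumes R: "presents R G F" and R': "presents R' H F'" and \<phi>: "tgi G H \<phi>"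
    and G: "closed_group G" and H: "closed_group H"
  shows "\<exists>f. bij f \<and> (\<forall>a b c. R a b c \<longleftrightarrow> R' (f a) (f b) (f c))"
proof (intro exI conjI allI)
  define f where "f a = inv_into UNIV F' (\<phi> ` F a)" for a
  have F: "bij_betw F UNIV {A. open_coset G A}" and F': "bij_betw F' UNIV {A. open_coset H A}"
    using R R' by (auto simp: presents_def)
  have "bij_betw (inv_into UNIV F' \<circ> ((`) \<phi> \<circ> F)) UNIV UNIV"
    using F bij_betw_open_cosets[OF \<phi> G H] bij_betw_inv_into[OF F'] by (intro bij_betw_trans)
  then show "bij f" unfolding f_def comp_def .
  have cos: "open_coset G (F a)" for a using bij_betw_apply[OF F] by blast
  have "\<phi> ` F a \<in> {A. open_coset H A}" for a using open_coset_image[OF \<phi> G H cos] by blast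
  then have Ff: "F' (f a) = \<phi> ` F a" for a
    unfolding f_def by (rule bij_betw_inv_into_right[OF F'])
  have "F a \<subseteq> G" for a using open_coset_subset[OF cos] by blast
  then have "prod_sub (F' (f a)) (F' (f b)) (F' (f c)) \<longleftrightarrow> prod_sub (F a) (F b) (F c)" for a b c
    unfolding Ff by (intro prod_sub_image[OF \<phi> G]) auto
  then show "R a b c \<longleftrightarrow> R' (f a) (f b) (f c)" for a b c
    using R R' by (simp add: presents_def)
qed

lemma presents_reindex:
  assumes "presents R G F" "bij f" "\<And>a b c. R' a b c \<longleftrightarrow> R (f a) (f b) (f c)"
  shows "presents R' G (F \<circ> f)"
  using assms bij_betw_trans[of f UNIV UNIV F] by (auto simp: presents_def)

text \<open>The image is closed because convergence of \<open>\<phi> g\<^sub>n\<close> to a permutation forces convergence of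
  \<open>g\<^sub>n\<close> and of the inverses of \<open>g\<^sub>n\<close>.\<close>

lemma tgi_closed_image:
  assumes G: "closed_group G" and bij: "\<And>g. g \<in> G \<Longrightarrow> bij (\<phi> g)"
    and hom: "\<And>g h. g \<in> G \<Longrightarrow> h \<in> G \<Longrightarrow> \<phi> (g \<circ> h) = \<phi> g \<circ> \<phi> h"
    and cont: "\<And>y. \<exists>x. \<forall>g\<in>G. \<forall>h\<in>G. map g x = map h x \<longrightarrow> map (\<phi> g) y = map (\<phi> h) y"
    and cont_inv: "\<And>x. \<exists>y. \<forall>g\<in>G. \<forall>h\<in>G. map (\<phi> g) y = map (\<phi> h) y \<longrightarrow> map g x = map h x"
  shows "pset (tr (\<phi> ` G)) = \<phi> ` G" and "tgi G (\<phi> ` G) \<phi>"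
proof -
  interpret closed_group G by fact
  have inj: "inj_on \<phi> G"
  proof (rule inj_onI, rule ext)
    fix g h a assume gh: "g \<in> G" "h \<in> G" "\<phi> g = \<phi> h"
    obtain y where "\<forall>g\<in>G. \<forall>h\<in>G. map (\<phi> g) y = map (\<phi> h) y \<longrightarrow> map g [a] = map h [a]"
      using cont_inv by blast
    then show "g a = h a" using gh by auto
  qed
  then show "tgi G (\<phi> ` G) \<phi>"
    unfolding tgi_def using cont cont_inv hom by (auto simp: bij_betw_def simp del: map_eq_conv)
  show "pset (tr (\<phi> ` G)) = \<phi> ` G"
  proof
    show "\<phi> ` G \<subseteq> pset (tr (\<phi> ` G))" using bij by (auto simp: pset_def trI)
    show "pset (tr (\<phi> ` G)) \<subseteq> \<phi> ` G"
    proof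
      fix p assume p: "p \<in> pset (tr (\<phi> ` G))"
      then have bp: "bij p" by (rule pset_bij)
      have "\<exists>g\<in>G. map (\<phi> g) x = map p x" for x
        using p by (auto simp: pset_def tr_def)
      then obtain \<gamma> where \<gamma>: "\<And>x. \<gamma> x \<in> G" "\<And>x. map (\<phi> (\<gamma> x)) x = map p x" by metis
      obtain X where X: "\<And>a g h. g \<in> G \<Longrightarrow> h \<in> G \<Longrightarrow> map (\<phi> g) (X a) = map (\<phi> h) (X a) \<Longrightarrow> g a = h a"
      proof -
        have "\<exists>y. \<forall>g\<in>G. \<forall>h\<in>G. map (\<phi> g) y = map (\<phi> h) y \<longrightarrow> g a = h a" for a
          using cont_inv[of "[a]"] by simp
        then show ?thesis using that by metis
      qed
      \<comment> \<open>\<open>\<gamma> x\<close> imitates \<open>p\<close> on the tuple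
        \<open>x\<close>, and \<open>X a\<close> is a tuple whose images decide the value at
        \<open>a\<close>. Hence \<open>\<gamma> w a\<close> is constant once \<open>w\<close>
        contains \<open>X a\<close>, and \<open>k\<close> is the pointwise limit.\<close>
      define k where "k a = \<gamma> (X a) a" for a
      have k: "\<gamma> w a = k a" if w: "set (X a) \<subseteq> set w" for w a
        unfolding k_def
      proof (rule X[OF \<gamma>(1) \<gamma>(1)])
        have "map (\<phi> (\<gamma> w)) (X a) = map p (X a)" using \<gamma>(2)[of w] w by auto
        then show "map (\<phi> (\<gamma> w)) (X a) = map (\<phi> (\<gamma> (X a))) (X a)" using \<gamma>(2) by simp
      qed
      have kr: "map k r = map (\<gamma> w) r" if "set (concat (map X r)) \<subseteq> set w" for r w
        using k that by (auto simp: UN_subset_iff)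
      have "tr G r (map k r)" for r
        using kr[of r "concat (map X r)"] \<gamma>(1) by (metis order_refl trI)
      moreover have "bij k"
      proof (rule bijI)
        show "inj k"
        proof (rule injI)
          fix a b assume ab: "k a = k b"
          have "map k [a, b] = map (\<gamma> (X a @ X b)) [a, b]" by (rule kr) simp
          then have "\<gamma> (X a @ X b) a = \<gamma> (X a @ X b) b" using ab by simp
          then show "a = b" using bij_mem[OF \<gamma>(1)] by (metis pinv_apply(1))
        qed
        show "surj k"
        proof (rule surjI)
          fix b
          \<comment> \<open>\<open>h\<close> imitates \<open>p\<close> on \<open>z\<close>, so its
            image under \<open>\<phi>\<close> takes \<open>z\<close> to \<open>X b\<close>.
            Enlarging \<open>z\<close> by \<open>X a\<close> makes \<open>\<gamma> w a\<close> equal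
            to \<open>k a\<close>, while \<open>\<gamma> w \<circ> pinv h\<close> still acts
            trivially on \<open>X b\<close> and therefore fixes \<open>b\<close>; this reads
            \<open>k a = b\<close>.\<close>
          define z where "z = map (pinv p) (X b)"
          define h where "h = \<gamma> z"
          define a where "a = pinv h b"
          define w where "w = z @ X a"
          have hG: "h \<in> G" and wG: "\<gamma> w \<in> G" by (simp_all add: h_def \<gamma>)
          have pz: "map p z = X b" using bp by (simp add: z_def pinv_comp_right)
          have hz: "map (\<phi> h) z = X b" using \<gamma>(2)[of z] pz by (simp add: h_def)
          then have hX: "map (\<phi> (pinv h)) (X b) = z"
            using hom_pinv[of G \<phi> h, OF G bij hom hG] map_eq_iff_map_pinv[OF bij[OF hG]] by simp
          have "map (\<phi> (\<gamma> w)) z = map p z" using \<gamma>(2)[of w] by (simp add: w_def)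
          then have "map (\<phi> (\<gamma> w)) (map (\<phi> (pinv h)) (X b)) = X b"
            by (simp only: hX pz)
          then have "map (\<phi> (\<gamma> w \<circ> pinv h)) (X b) = map (\<phi> id) (X b)"
            by (simp add: hom[OF wG inv_mem[OF hG]] hom_id[of G \<phi>, OF G bij hom])
          then have "(\<gamma> w \<circ> pinv h) b = id b"
            by (rule X[OF comp_mem[OF wG inv_mem[OF hG]] id_mem])
          then have "\<gamma> w a = b" by (simp add: a_def)
          then show "k a = b" using k[of a w] by (simp add: w_def)
        qed
      qed
      ultimately have kG: "k \<in> G" using closed_mem by (auto simp: pset_def)
      have "\<phi> k i = p i" for i
      proof -
        obtain x where x: "\<forall>g\<in>G. \<forall>h\<in>G. map g x = map h x \<longrightarrow> map (\<phi> g) [i] = map (\<phi> h) [i]"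
          using cont by blast
        \<comment> \<open>The entry \<open>i\<close> makes the image of \<open>\<gamma> w\<close>
          agree with \<open>p\<close> at \<open>i\<close>; the other entries make
          \<open>\<gamma> w\<close> agree with \<open>k\<close> on \<open>x\<close>, hence their
          images under \<open>\<phi>\<close> agree at \<open>i\<close>.\<close>
        define w where "w = i # concat (map X x)"
        have "map k x = map (\<gamma> w) x" by (rule kr) (auto simp: w_def)
        then have "map (\<phi> k) [i] = map (\<phi> (\<gamma> w)) [i]" using x kG \<gamma>(1) by blast
        moreover have "\<phi> (\<gamma> w) i = p i" using \<gamma>(2)[of w] by (simp add: w_def)
        ultimately show ?thesis by simp
      qed
      then have "\<phi> k = p" by (rule ext)
      then show "p \<in> \<phi> ` G" using kG by blast
    qed
  qed
qed

section \<open>Coding the open cosets of an oligomorphic group\<close>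

type_synonym coset_code = "nat list \<times> nat list \<times> nat list list"

text \<open>For an open coset, \<open>s\<close> is the image of \<open>r\<close> under one member,
  and \<open>zs\<close> lists the orbits that \<open>s\<close> forms together with the images of
  \<open>r\<close> under all members. Codes form a countable type that does not mention
  \<open>G\<close>, so one enumeration serves every group; a code in general need not give a
  coset.\<close>

fun dset :: "(nat \<Rightarrow> nat) set \<Rightarrow> coset_code \<Rightarrow> (nat \<Rightarrow> nat) set" where
  "dset G (r, s, zs) = {g\<in>G. \<exists>z\<in>set zs. tr G z (s @ map g r)}"

text \<open>The trace of the coded set written with the trace of the group alone: \<open>w\<close>
  stands for the image of \<open>r\<close> under a permutation that takes \<open>x\<close> to
  \<open>y\<close>.\<close>

fun dcode :: "(nat list \<Rightarrow> nat list \<Rightarrow> bool) \<Rightarrow> coset_code \<Rightarrow> nat list \<Rightarrow> nat list \<Rightarrow> bool" where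
  "dcode T (r, s, zs) x y \<longleftrightarrow> length x = length y \<and> (\<exists>z\<in>set zs. \<exists>w. T (x @ r) (y @ w) \<and> T z (s @ w))"

text \<open>Nonemptiness and closure under triples, both read on traces; openness is automatic for
  coded sets. The last clause keeps only the least code of each coset, so that the enumeration has
  no repetitions.\<close>

definition valid_code :: "(nat list \<Rightarrow> nat list \<Rightarrow> bool) \<Rightarrow> nat \<Rightarrow> bool" where
  "valid_code T j \<longleftrightarrow> dcode T (from_nat j) [] [] \<and>
     (\<forall>x y z w. dcode T (from_nat j) x y \<longrightarrow> dcode T (from_nat j) z y \<longrightarrow>
        dcode T (from_nat j) z w \<longrightarrow> dcode T (from_nat j) x w) \<and>
     (\<forall>i<j. \<exists>x y. dcode T (from_nat i) x y \<noteq> dcode T (from_nat j) x y)"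

definition coset_tr :: "(nat list \<Rightarrow> nat list \<Rightarrow> bool) \<Rightarrow> nat \<Rightarrow> nat list \<Rightarrow> nat list \<Rightarrow> bool" where
  "coset_tr T k = dcode T (from_nat (enumerate {j. valid_code T j} k))"

definition coset_rel :: "(nat list \<Rightarrow> nat list \<Rightarrow> bool) \<Rightarrow> nat \<Rightarrow> nat \<Rightarrow> nat \<Rightarrow> bool" where
  "coset_rel T k l m \<longleftrightarrow> (\<forall>x y z. coset_tr T k y z \<longrightarrow> coset_tr T l x y \<longrightarrow> coset_tr T m x z)"

lemma tr_dset: "tr (dset G c) = dcode (tr G) c"
proof (cases c)
  case (fields r s zs)
  show ?thesis
  proof (intro ext iffI)
    fix x y assume "tr (dset G c) x y"
    then obtain g where g: "g \<in> dset G c" "map g x = y" by (auto simp: tr_def)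
    then obtain z where "z \<in> set zs" "tr G z (s @ map g r)" "g \<in> G" by (auto simp: fields)
    moreover have "tr G (x @ r) (y @ map g r)" using trI[OF \<open>g \<in> G\<close>, of "x @ r"] g by simp
    ultimately show "dcode (tr G) c x y" using g by (auto simp: fields)
  next
    fix x y assume "dcode (tr G) c x y"
    then obtain z w where zw: "length x = length y" "z \<in> set zs" "tr G (x @ r) (y @ w)" "tr G z (s @ w)"
      by (auto simp: fields)
    then obtain g where "g \<in> G" "map g x = y" "map g r = w" by (auto simp: tr_def)
    moreover have "g \<in> dset G c" using \<open>g \<in> G\<close> \<open>map g r = w\<close> zw by (auto simp: fields)
    ultimately show "tr (dset G c) x y" using trI by blast
  qed
qed

context closed_group
begin

lemma dset_subset: "dset G c \<subseteq> G"
  by (cases c) auto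

lemma dset_open:
  obtains r where "\<And>a g. a \<in> dset G c \<Longrightarrow> g \<in> G \<Longrightarrow> map g r = map a r \<Longrightarrow> g \<in> dset G c"
proof (cases c)
  case (fields r s zs)
  show ?thesis by (rule that[of r]) (auto simp: fields simp del: map_eq_conv)
qed

lemma pset_dcode: "pset (dcode (tr G) c) = dset G c"
proof -
  obtain r where "\<And>a g. a \<in> dset G c \<Longrightarrow> g \<in> G \<Longrightarrow> map g r = map a r \<Longrightarrow> g \<in> dset G c"
    using dset_open by metis
  then show ?thesis
    unfolding tr_dset[symmetric] by (rule closed_if_uniformly_open[OF dset_subset])
qed

lemma dcode_eq_iff: "dcode (tr G) c = dcode (tr G) d \<longleftrightarrow> dset G c = dset G d"
proof
  show "dset G c = dset G d" if "dcode (tr G) c = dcode (tr G) d"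
    using arg_cong[OF that, of pset] by (simp only: pset_dcode)
  show "dcode (tr G) c = dcode (tr G) d" if "dset G c = dset G d"
    using arg_cong[OF that, of tr] by (simp only: tr_dset)
qed

lemma valid_code_iff:
  "valid_code (tr G) j \<longleftrightarrow> open_coset G (dset G (from_nat j)) \<and>
     (\<forall>i<j. dset G (from_nat i) \<noteq> dset G (from_nat j))"
proof -
  define D where "D = dset G (from_nat j)"
  have D: "D \<subseteq> G" "D \<subseteq> {f. bij f}" using dset_subset bij_mem unfolding D_def by blast+
  have "pset (tr D) \<subseteq> D" unfolding D_def tr_dset pset_dcode by simp
  then have triple: "(\<forall>x y z w. tr D x y \<longrightarrow> tr D z y \<longrightarrow> tr D z w \<longrightarrow> tr D x w) \<longleftrightarrow>
      (\<forall>a\<in>D. \<forall>b\<in>D. \<forall>c\<in>D. a \<circ> pinv b \<circ> c \<in> D)"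
    using triple_iff_tr[OF D(2)] by blast
  have ne: "tr D [] [] \<longleftrightarrow> D \<noteq> {}" by (auto simp: tr_def)
  have op: "\<exists>r. \<forall>a\<in>D. \<forall>g\<in>G. map g r = map a r \<longrightarrow> g \<in> D"
    unfolding D_def using dset_open[of "from_nat j"] by metis
  have "valid_code (tr G) j \<longleftrightarrow> tr D [] [] \<and>
      (\<forall>x y z w. tr D x y \<longrightarrow> tr D z y \<longrightarrow> tr D z w \<longrightarrow> tr D x w) \<and>
      (\<forall>i<j. dcode (tr G) (from_nat i) \<noteq> dcode (tr G) (from_nat j))"
    unfolding valid_code_def D_def tr_dset fun_eq_iff by blast
  then show ?thesis
    unfolding triple ne dcode_eq_iff using D(1) op unfolding open_coset_def D_def by blast
qed

end

context oligo_group
begin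

lemma finite_reps_obtain:
  obtains zs where "\<And>x. length x = n \<Longrightarrow> \<exists>z\<in>set zs. tr G z x"
proof -
  have "\<exists>zs. \<forall>x. length x = n \<longrightarrow> (\<exists>z\<in>set zs. tr G z x)"
    using finite_reps_tr unfolding finite_reps_def by (rule spec)
  then obtain zs where "\<forall>x. length x = n \<longrightarrow> (\<exists>z\<in>set zs. tr G z x)" ..
  then show ?thesis by (intro that[of zs]) simp
qed

text \<open>If \<open>A\<close> contains the stabiliser coset of \<open>r\<close> at \<open>a\<close>, then membership of \<open>g\<close> in \<open>A\<close> depends
  only on the orbit of the tuple formed by \<open>a(r)\<close> and \<open>g(r)\<close>, and there are finitely many such
  orbits.\<close>

lemma open_coset_has_code:
  assumes A: "open_coset G A"
  shows "\<exists>c. dset G c = A"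
proof -
  obtain r where r: "\<And>a g. a \<in> A \<Longrightarrow> g \<in> G \<Longrightarrow> map g r = map a r \<Longrightarrow> g \<in> A"
    using open_coset_open[OF A] by metis
  note AG = open_coset_subset[OF A]
  obtain a where a: "a \<in> A" using open_coset_nonempty[OF A] by blast
  define s where "s = map a r"
  obtain zs where zs: "\<And>x. length x = length (r @ r) \<Longrightarrow> \<exists>z\<in>set zs. tr G z x"
    using finite_reps_obtain by blast
  define ws where "ws = filter (\<lambda>z. \<exists>c\<in>A. tr G z (s @ map c r)) zs"
  have "dset G (r, s, ws) = A"
  proof
    show "A \<subseteq> dset G (r, s, ws)"
    proof
      fix g assume g: "g \<in> A"
      obtain z where "z \<in> set zs" "tr G z (s @ map g r)" using zs[of "s @ map g r"] by (auto simp: s_def)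
      then show "g \<in> dset G (r, s, ws)" using g AG by (auto simp: ws_def)
    qed
    show "dset G (r, s, ws) \<subseteq> A"
    proof
      fix g assume "g \<in> dset G (r, s, ws)"
      then obtain z c where g: "g \<in> G" "tr G z (s @ map g r)" and c: "c \<in> A" "tr G z (s @ map c r)"
        by (auto simp: ws_def)
      have "tr G (s @ map g r) (s @ map c r)"
        using orbit_system_trans[OF orbit_system_tr orbit_system_sym[OF orbit_system_tr g(2)] c(2)] .
      \<comment> \<open>\<open>h\<close> fixes \<open>a(r)\<close> and takes \<open>g(r)\<close> to
        \<open>c(r)\<close>. So \<open>h \<circ> a\<close> agrees with \<open>a\<close> on
        \<open>r\<close> and \<open>h \<circ> g\<close> agrees with \<open>c\<close> on
        \<open>r\<close>: both are in \<open>A\<close>, and a triple built from them and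
        \<open>a\<close> equals \<open>g\<close>.\<close>
      then obtain h where h: "h \<in> G" "map h s = s" "map h (map g r) = map c r"
        by (auto simp: tr_def s_def simp del: map_eq_conv map_map)
      have "h \<circ> a \<in> A"
        using r[OF a comp_mem[OF h(1) AG[OF a]]] h(2) by (simp add: s_def del: map_eq_conv)
      moreover have "h \<circ> g \<in> A"
        using r[OF c(1) comp_mem[OF h(1) g(1)]] h(3) by (simp del: map_eq_conv)
      ultimately have "a \<circ> pinv (h \<circ> a) \<circ> (h \<circ> g) \<in> A"
        using open_coset_triple[OF A a] by blast
      moreover have "a \<circ> pinv (h \<circ> a) \<circ> (h \<circ> g) = g"
        using bij_mem[OF h(1)] bij_mem[OF AG[OF a]] by (simp add: o_inv_distrib fun_eq_iff)
      ultimately show "g \<in> A" by simp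
    qed
  qed
  then show ?thesis by blast
qed

text \<open>Finitely many orbits cover the infinitely many points, so one orbit is infinite and its
  points give distinct cosets. Infinity is what makes \<open>enumerate\<close> a bijection from all
  natural numbers.\<close>

lemma infinite_open_cosets: "infinite {A. open_coset G A}"
proof -
  obtain zs where zs: "\<And>x. length x = 1 \<Longrightarrow> \<exists>z\<in>set zs. tr G z x"
    using finite_reps_obtain by blast
  have "(UNIV :: nat set) = (\<Union>z\<in>set zs. {x. tr G z [x]})" using zs by auto
  then have "\<not> (\<forall>z\<in>set zs. finite {x. tr G z [x]})"
    by (metis (no_types, lifting) List.finite_set finite_UN_I infinite_UNIV_nat)
  then obtain z where z: "infinite {x. tr G z [x]}" by blast
  have "inj_on (\<lambda>x. {g\<in>G. map g z = [x]}) {x. tr G z [x]}"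
    by (rule inj_onI) (fastforce simp: tr_def)
  moreover have "(\<lambda>x. {g\<in>G. map g z = [x]}) ` {x. tr G z [x]} \<subseteq> {A. open_coset G A}"
    using open_coset_mapsto by blast
  ultimately show ?thesis using z by (meson finite_imageD finite_subset)
qed

lemma bij_betw_valid_code:
  "bij_betw (\<lambda>j. dset G (from_nat j)) {j. valid_code (tr G) j} {A. open_coset G A}"
  unfolding bij_betw_def
proof
  show "inj_on (\<lambda>j. dset G (from_nat j)) {j. valid_code (tr G) j}"
  proof (rule inj_onI, rule ccontr)
    fix i j assume ij: "i \<in> {j. valid_code (tr G) j}" "j \<in> {j. valid_code (tr G) j}"
      "dset G (from_nat i) = dset G (from_nat j)" "i \<noteq> j"
    from ij(4) consider "i < j" | "j < i" by linarith
    then show False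
      using ij(1-3) by cases (auto simp: valid_code_iff)
  qed
  show "(\<lambda>j. dset G (from_nat j)) ` {j. valid_code (tr G) j} = {A. open_coset G A}"
  proof
    show "(\<lambda>j. dset G (from_nat j)) ` {j. valid_code (tr G) j} \<subseteq> {A. open_coset G A}"
      using valid_code_iff by auto
    show "{A. open_coset G A} \<subseteq> (\<lambda>j. dset G (from_nat j)) ` {j. valid_code (tr G) j}"
    proof
      fix A assume "A \<in> {A. open_coset G A}"
      then have A: "open_coset G A" by simp
      define j where "j = (LEAST j. dset G (from_nat j) = A)"
      have "\<exists>j. dset G (from_nat j) = A" using open_coset_has_code[OF A] by (metis from_nat_to_nat)
      then have j: "dset G (from_nat j) = A" unfolding j_def by (rule LeastI_ex)
      moreover have "dset G (from_nat i) \<noteq> A" if "i < j" for i using not_less_Least that unfolding j_def by blast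
      ultimately have "valid_code (tr G) j" using A valid_code_iff by auto
      then show "A \<in> (\<lambda>j. dset G (from_nat j)) ` {j. valid_code (tr G) j}" using j by blast
    qed
  qed
qed

lemma pset_coset_tr:
  "pset (coset_tr (tr G) k) = dset G (from_nat (enumerate {j. valid_code (tr G) j} k))"
  unfolding coset_tr_def by (rule pset_dcode)

lemma tr_pset_coset_tr: "tr (pset (coset_tr (tr G) k)) = coset_tr (tr G) k"
  unfolding pset_coset_tr tr_dset by (simp only: coset_tr_def)

lemma infinite_valid_code: "infinite {j. valid_code (tr G) j}"
  unfolding bij_betw_finite[OF bij_betw_valid_code] by (rule infinite_open_cosets)

lemma presents_coset_rel: "presents (coset_rel (tr G)) G (\<lambda>k. pset (coset_tr (tr G) k))"
proof -
  let ?F = "\<lambda>k. pset (coset_tr (tr G) k)"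
  have "bij_betw (enumerate {j. valid_code (tr G) j}) UNIV {j. valid_code (tr G) j}"
    using infinite_valid_code by (rule bij_enumerate)
  from bij_betw_trans[OF this bij_betw_valid_code]
  have bij: "bij_betw ?F UNIV {A. open_coset G A}"
    unfolding pset_coset_tr comp_def .
  have "open_coset G (?F k)" for k using bij_betw_apply[OF bij] by blast
  then have "?F k \<subseteq> {f. bij f}" "pset (tr (?F k)) \<subseteq> ?F k" for k
    using open_coset_bij open_coset_closed by blast+
  then have "coset_rel (tr G) k l m \<longleftrightarrow> prod_sub (?F k) (?F l) (?F m)" for k l m
    unfolding coset_rel_def by (subst prod_sub_iff_tr) (auto simp: tr_pset_coset_tr)
  then show ?thesis using bij unfolding presents_def by blast
qed

end

section \<open>Recovering a group from its coset structure\<close>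

text \<open>In a coset structure the first conjunct gives \<open>c V \<subseteq> c\<close>; the second excludes cosets of larger
  subgroups and forces \<open>V\<close> to be a subgroup.\<close>

definition lcosets :: "(nat \<Rightarrow> nat \<Rightarrow> nat \<Rightarrow> bool) \<Rightarrow> nat \<Rightarrow> nat set" where
  "lcosets R V = {c. R c V c \<and> (\<exists>d. R d c V)}"

text \<open>For left cosets \<open>L\<close> and \<open>L'\<close> of \<open>V\<close>, the relation
  \<open>c L \<subseteq> L'\<close> means that every member of \<open>c\<close> carries
  \<open>L\<close> onto \<open>L'\<close>. The enumeration of the left cosets turns this into an
  action on natural numbers.\<close>

definition lc_moves :: "(nat \<Rightarrow> nat \<Rightarrow> nat \<Rightarrow> bool) \<Rightarrow> nat \<Rightarrow> nat \<Rightarrow> nat list \<Rightarrow> nat list \<Rightarrow> bool" where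
  "lc_moves R V c x y \<longleftrightarrow>
     list_all2 (\<lambda>i j. R c (enumerate (lcosets R V) i) (enumerate (lcosets R V) j)) x y"

text \<open>An open coset \<open>c\<close> replaces a single group element; by continuity of the
  action, each element has an open coset around it that moves \<open>x\<close> in the same
  way.\<close>

definition action_tr :: "(nat \<Rightarrow> nat \<Rightarrow> nat \<Rightarrow> bool) \<Rightarrow> nat \<Rightarrow> nat list \<Rightarrow> nat list \<Rightarrow> bool" where
  "action_tr R V x y \<longleftrightarrow> (\<exists>c. lc_moves R V c x y)"

text \<open>Inclusion of open cosets: if \<open>c\<close> is a left coset of a subgroup
  \<open>u\<close>, then \<open>c u = c\<close>, and the second conjunct places this product inside
  \<open>a\<close>.\<close>

definition coset_le :: "(nat \<Rightarrow> nat \<Rightarrow> nat \<Rightarrow> bool) \<Rightarrow> nat \<Rightarrow> nat \<Rightarrow> bool" where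
  "coset_le R c a \<longleftrightarrow> (\<exists>u. R c u c \<and> R c u a)"

text \<open>In a coset structure this is the trace of the image of the coset \<open>a\<close> under
  the action on left cosets of \<open>V\<close>.\<close>

definition canon_tr :: "(nat \<Rightarrow> nat \<Rightarrow> nat \<Rightarrow> bool) \<Rightarrow> nat \<Rightarrow> nat \<Rightarrow> nat list \<Rightarrow> nat list \<Rightarrow> bool" where
  "canon_tr R V a x y \<longleftrightarrow> (\<exists>c. coset_le R c a \<and> lc_moves R V c x y)"

text \<open>The last conjunct says that every open coset contains a nonempty basic open set of the topology
  induced by the action on left cosets of \<open>V\<close>.\<close>

definition good :: "(nat \<Rightarrow> nat \<Rightarrow> nat \<Rightarrow> bool) \<Rightarrow> nat \<Rightarrow> bool" where
  "good R V \<longleftrightarrow> (\<forall>n. \<exists>m>n. m \<in> lcosets R V) \<and>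
     orbit_system (action_tr R V) \<and> finite_reps (action_tr R V) \<and>
     (\<forall>c. \<exists>x y. action_tr R V x y \<and> (\<forall>d. lc_moves R V d x y \<longrightarrow> coset_le R d c))"

definition matches :: "(nat \<Rightarrow> nat \<Rightarrow> nat \<Rightarrow> bool) \<Rightarrow> nat \<Rightarrow> nat \<Rightarrow> nat \<Rightarrow> bool" where
  "matches R V a k \<longleftrightarrow> (\<forall>x y. canon_tr R V a x y \<longleftrightarrow> coset_tr (action_tr R V) k x y)"

text \<open>Says that \<open>matches\<close> is the graph of an isomorphism from \<open>R\<close> to
  the coset structure of the rebuilt group, through quantifiers over numbers only; asserting a
  bijection directly would quantify over functions.\<close>

definition canonical :: "(nat \<Rightarrow> nat \<Rightarrow> nat \<Rightarrow> bool) \<Rightarrow> nat \<Rightarrow> bool" where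
  "canonical R V \<longleftrightarrow> (\<forall>a. \<exists>k. matches R V a k) \<and> (\<forall>k. \<exists>a. matches R V a k) \<and>
     (\<forall>a b k. matches R V a k \<longrightarrow> matches R V b k \<longrightarrow> a = b) \<and>
     (\<forall>a b c k l m. matches R V a k \<longrightarrow> matches R V b l \<longrightarrow> matches R V c m \<longrightarrow>
        (R a b c \<longleftrightarrow> coset_rel (action_tr R V) k l m))"

lemma list_all2_map_eq_iff:
  assumes "S \<noteq> {}"
  shows "list_all2 (\<lambda>i j. \<forall>g\<in>S. f g i = j) x y \<longleftrightarrow> (\<forall>g\<in>S. map (f g) x = y)"
  using assms by (auto simp: list_all2_conv_all_nth list_eq_iff_nth_eq)

lemma uniform_on_lists:
  assumes "\<And>i. \<exists>r. \<forall>g\<in>G. \<forall>h\<in>G. map g r = map h r \<longrightarrow> f g i = f h i"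
  shows "\<exists>r. \<forall>g\<in>G. \<forall>h\<in>G. map g r = map h r \<longrightarrow> map (f g) x = map (f h) x"
proof (induction x)
  case (Cons i x)
  obtain r where r: "\<forall>g\<in>G. \<forall>h\<in>G. map g r = map h r \<longrightarrow> map (f g) x = map (f h) x"
    using Cons.IH by blast
  obtain s where s: "\<forall>g\<in>G. \<forall>h\<in>G. map g s = map h s \<longrightarrow> f g i = f h i"
    using assms by blast
  show ?case
  proof (intro exI[of _ "r @ s"] ballI impI)
    fix g h assume gh: "g \<in> G" "h \<in> G" "map g (r @ s) = map h (r @ s)"
    then have "map g r = map h r" "map g s = map h s" by simp_all
    then have "map (f g) x = map (f h) x" "f g i = f h i" using r s gh(1,2) by blast+
    then show "map (f g) (i # x) = map (f h) (i # x)" by simp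
  qed
qed simp

section \<open>Open cosets as elements of a structure\<close>

locale presentation = oligo_group G for G +
  fixes R :: "nat \<Rightarrow> nat \<Rightarrow> nat \<Rightarrow> bool" and F :: "nat \<Rightarrow> (nat \<Rightarrow> nat) set"
  assumes presents: "presents R G F"
begin

lemma F_bij: "bij_betw F UNIV {A. open_coset G A}"
  using presents by (simp add: presents_def)

lemma F_coset: "open_coset G (F a)"
  using bij_betw_apply[OF F_bij] by blast

lemma F_eq_iff: "F a = F b \<longleftrightarrow> a = b"
  using F_bij by (auto simp: bij_betw_def inj_def)

lemma F_surj: "open_coset G A \<Longrightarrow> \<exists>a. F a = A"
  using F_bij by (metis (mono_tags, lifting) bij_betw_inv_into_right mem_Collect_eq)

lemma R_iff: "R a b c \<longleftrightarrow> prod_sub (F a) (F b) (F c)"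
  using presents by (simp add: presents_def)

lemma F_mem: "g \<in> F a \<Longrightarrow> g \<in> G"
  by (rule open_coset_subset[OF F_coset])

lemma F_nonempty: "\<exists>g. g \<in> F a"
  using open_coset_nonempty[OF F_coset] by blast

text \<open>With \<open>g\<close> in \<open>c\<close> and \<open>h\<close> in \<open>u\<close>, both
  \<open>g\<close> and \<open>g \<circ> h\<close> are in \<open>c\<close>, hence so is
  \<open>g \<circ> pinv h\<close>; multiplying by \<open>h\<close> recovers \<open>g\<close> inside
  \<open>a\<close>. Conversely, the subgroup obtained by translating \<open>c\<close> by
  \<open>pinv g\<close> is a witness \<open>u\<close>.\<close>

lemma coset_le_iff: "coset_le R c a \<longleftrightarrow> F c \<subseteq> F a"
proof
  assume "coset_le R c a"
  then obtain u where u: "prod_sub (F c) (F u) (F c)" "prod_sub (F c) (F u) (F a)"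
    by (auto simp: coset_le_def R_iff)
  show "F c \<subseteq> F a"
  proof
    fix g assume g: "g \<in> F c"
    obtain h where h: "h \<in> F u" using F_nonempty by blast
    have bij: "bij g" "bij h" using g h F_mem bij_mem by auto
    have "g \<circ> h \<in> F c" using u(1) g h by (simp add: prod_sub_def)
    then have "g \<circ> pinv (g \<circ> h) \<circ> g \<in> F c" using open_coset_triple[OF F_coset] g by blast
    moreover have "g \<circ> pinv (g \<circ> h) \<circ> g = g \<circ> pinv h" using bij by (simp add: o_inv_distrib fun_eq_iff)
    ultimately have "(g \<circ> pinv h) \<circ> h \<in> F a" using u(2) h by (auto simp: prod_sub_def)
    moreover have "(g \<circ> pinv h) \<circ> h = g" using bij by (simp add: fun_eq_iff)
    ultimately show "g \<in> F a" by simp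
  qed
next
  assume sub: "F c \<subseteq> F a"
  obtain g where g: "g \<in> F c" using F_nonempty by blast
  obtain u where u: "F u = (\<circ>) (pinv g) ` F c"
    using F_surj open_coset_left[OF F_coset inv_mem[OF F_mem[OF g]]] by metis
  have "prod_sub (F c) (F u) (F c)"
    unfolding prod_sub_def u using open_coset_triple[OF F_coset _ g] by (auto simp: o_assoc)
  moreover from this have "prod_sub (F c) (F u) (F a)" using sub by (auto simp: prod_sub_def)
  ultimately show "coset_le R c a" by (auto simp: coset_le_def R_iff)
qed

text \<open>Having a left coset in the sense of \<open>lcosets\<close> yields some \<open>u\<close>
  in \<open>V\<close> with \<open>u \<circ> u\<close> in \<open>V\<close>. Then
  \<open>u \<circ> pinv (u \<circ> u) \<circ> u = id\<close> is in \<open>V\<close>, and a coset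
  containing the identity is a subgroup.\<close>

lemma lcosets_group:
  assumes "a \<in> lcosets R V" "v \<in> F V" "w \<in> F V"
  shows "pinv v \<circ> w \<in> F V"
proof -
  obtain d where d: "prod_sub (F a) (F V) (F a)" "prod_sub (F d) (F a) (F V)"
    using assms(1) by (auto simp: lcosets_def R_iff)
  obtain a0 d0 where a0: "a0 \<in> F a" and d0: "d0 \<in> F d" using F_nonempty by metis
  define u where "u = d0 \<circ> a0"
  have uV: "u \<in> F V" using d(2) a0 d0 by (simp add: u_def prod_sub_def)
  then have "a0 \<circ> u \<in> F a" using d(1) a0 by (simp add: prod_sub_def)
  then have "d0 \<circ> (a0 \<circ> u) \<in> F V" using d(2) d0 by (simp add: prod_sub_def)
  then have "u \<circ> u \<in> F V" by (simp add: u_def o_assoc)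
  then have "u \<circ> pinv (u \<circ> u) \<circ> u \<in> F V" using open_coset_triple[OF F_coset] uV by blast
  moreover have "u \<circ> pinv (u \<circ> u) \<circ> u = id"
    using bij_mem[OF F_mem[OF uV]] by (simp add: o_inv_distrib fun_eq_iff)
  ultimately have "id \<in> F V" by simp
  then have "id \<circ> pinv v \<circ> w \<in> F V" using open_coset_triple[OF F_coset] assms(2,3) by blast
  then show ?thesis by simp
qed

text \<open>Both sides are left cosets of the same subgroup: \<open>h\<close> and
  \<open>g \<circ> a0\<close> in \<open>F b\<close> differ on the right by an element of
  \<open>V\<close>, which \<open>F a\<close> absorbs. Hence inclusion, which \<open>R\<close> can
  express, already means equality.\<close>

lemma lcosets_translate_eq:
  assumes a: "a \<in> lcosets R V" and b: "b \<in> lcosets R V" and g: "g \<in> G" and sub: "(\<circ>) g ` F a \<subseteq> F b"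
  shows "(\<circ>) g ` F a = F b"
proof
  show "F b \<subseteq> (\<circ>) g ` F a"
  proof
    fix h assume h: "h \<in> F b"
    obtain d where d: "prod_sub (F d) (F b) (F V)" using b by (auto simp: lcosets_def R_iff)
    obtain a0 d0 where a0: "a0 \<in> F a" and d0: "d0 \<in> F d" using F_nonempty by metis
    have bij: "bij g" "bij a0" "bij d0" using a0 d0 g F_mem bij_mem by auto
    have ga0: "g \<circ> a0 \<in> F b" using sub a0 by blast
    have "d0 \<circ> (g \<circ> a0) \<in> F V" "d0 \<circ> h \<in> F V" using d d0 h ga0 by (simp_all add: prod_sub_def)
    then have "pinv (d0 \<circ> (g \<circ> a0)) \<circ> (d0 \<circ> h) \<in> F V" by (rule lcosets_group[OF a])
    then have "a0 \<circ> (pinv (d0 \<circ> (g \<circ> a0)) \<circ> (d0 \<circ> h)) \<in> F a"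
      using a a0 by (auto simp: lcosets_def R_iff prod_sub_def)
    moreover have "g \<circ> (a0 \<circ> (pinv (d0 \<circ> (g \<circ> a0)) \<circ> (d0 \<circ> h))) = h"
      using bij by (simp add: o_inv_distrib bij_comp fun_eq_iff)
    ultimately show "h \<in> (\<circ>) g ` F a" by (metis imageI)
  qed
qed (rule sub)

definition act :: "(nat \<Rightarrow> nat) \<Rightarrow> nat \<Rightarrow> nat" where
  "act g a = inv_into UNIV F ((\<circ>) g ` F a)"

lemma F_act: "g \<in> G \<Longrightarrow> F (act g a) = (\<circ>) g ` F a"
  unfolding act_def using open_coset_left[OF F_coset] by (intro bij_betw_inv_into_right[OF F_bij]) auto

lemma act_comp: "g \<in> G \<Longrightarrow> h \<in> G \<Longrightarrow> act (g \<circ> h) a = act g (act h a)"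
  by (subst F_eq_iff[symmetric]) (auto simp: F_act comp_mem o_assoc image_image)

lemma act_id: "act id a = a"
  by (subst F_eq_iff[symmetric]) (simp add: F_act id_mem)

lemma act_lcosets:
  assumes a: "a \<in> lcosets R V" and g: "g \<in> G"
  shows "act g a \<in> lcosets R V"
proof -
  obtain d where d: "prod_sub (F a) (F V) (F a)" "prod_sub (F d) (F a) (F V)"
    using a by (auto simp: lcosets_def R_iff)
  \<comment> \<open>If \<open>d a \<subseteq> V\<close>, then multiplying \<open>d\<close> by
    \<open>pinv g\<close> on the right compensates the translation of \<open>a\<close> by
    \<open>g\<close>.\<close>
  obtain d' where d': "F d' = (\<lambda>a. a \<circ> pinv g) ` F d"
    using F_surj open_coset_right[OF F_coset inv_mem[OF g]] by metis
  have "prod_sub (F (act g a)) (F V) (F (act g a))"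
    using d(1) by (auto simp: F_act[OF g] prod_sub_def comp_assoc)
  moreover have "prod_sub (F d') (F (act g a)) (F V)"
    unfolding prod_sub_def F_act[OF g] d'
  proof clarify
    fix u v assume uv: "u \<in> F d" "v \<in> F a"
    have "u \<circ> pinv g \<circ> (g \<circ> v) = u \<circ> v" using bij_mem[OF g] by (simp add: fun_eq_iff)
    then show "u \<circ> pinv g \<circ> (g \<circ> v) \<in> F V" using d(2) uv by (simp add: prod_sub_def)
  qed
  ultimately show ?thesis by (auto simp: lcosets_def R_iff)
qed

lemma R_iff_act:
  assumes "a \<in> lcosets R V" "b \<in> lcosets R V"
  shows "R c a b \<longleftrightarrow> (\<forall>g\<in>F c. act g a = b)"
proof -
  have "act g a = b \<longleftrightarrow> (\<circ>) g ` F a \<subseteq> F b" if "g \<in> F c" for g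
    using lcosets_translate_eq[OF assms F_mem[OF that]] F_act[OF F_mem[OF that], of a]
    by (auto simp: F_eq_iff[symmetric])
  then show ?thesis by (auto simp: R_iff prod_sub_def)
qed

text \<open>The controlling tuple is \<open>b(r)\<close> rather than \<open>r\<close>: if
  \<open>g\<close> and \<open>h\<close> agree on it, then \<open>pinv h \<circ> g \<circ> b\<close>
  agrees with \<open>b\<close> on \<open>r\<close> and lies in \<open>F a\<close>, so
  \<open>pinv h \<circ> g\<close> maps \<open>F a\<close> into itself.\<close>

lemma act_continuous: "\<exists>r. \<forall>g\<in>G. \<forall>h\<in>G. map g r = map h r \<longrightarrow> act g a = act h a"
proof -
  obtain r where r: "\<And>b g. b \<in> F a \<Longrightarrow> g \<in> G \<Longrightarrow> map g r = map b r \<Longrightarrow> g \<in> F a"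
    using open_coset_open[OF F_coset] by metis
  obtain b where b: "b \<in> F a" using F_nonempty by blast
  have sub: "(\<circ>) g ` F a \<subseteq> (\<circ>) h ` F a"
    if gh: "g \<in> G" "h \<in> G" and eq: "map g (map b r) = map h (map b r)" for g h
  proof
    fix u assume "u \<in> (\<circ>) g ` F a"
    then obtain v where v: "v \<in> F a" "u = g \<circ> v" by blast
    have bij: "bij b" "bij h" using b gh F_mem bij_mem by auto
    have "map (pinv h \<circ> g \<circ> b) r = map (pinv h) (map g (map b r))" by simp
    also have "\<dots> = map (pinv h \<circ> h) (map b r)" unfolding eq by simp
    also have "\<dots> = map b r" by (simp add: pinv_comp_left[OF bij(2)])
    finally have "pinv h \<circ> g \<circ> b \<in> F a"
      by (intro r[OF b] comp_mem inv_mem gh F_mem[OF b])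
    then have "(pinv h \<circ> g \<circ> b) \<circ> pinv b \<circ> v \<in> F a"
      using open_coset_triple[OF F_coset] b v(1) by blast
    moreover have "h \<circ> ((pinv h \<circ> g \<circ> b) \<circ> pinv b \<circ> v) = u" using bij v(2) by (simp add: fun_eq_iff)
    ultimately show "u \<in> (\<circ>) h ` F a" by (metis imageI)
  qed
  show ?thesis
  proof (intro exI[of _ "map b r"] ballI impI)
    fix g h assume gh: "g \<in> G" "h \<in> G" "map g (map b r) = map h (map b r)"
    have "(\<circ>) g ` F a = (\<circ>) h ` F a" using sub[OF gh] sub[OF gh(2,1) gh(3)[symmetric]] by (rule equalityI)
    then show "act g a = act h a" by (simp add: act_def)
  qed
qed

end

section \<open>The action on the left cosets of \<open>V\<close>\<close>

locale lcoset_action = presentation +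
  fixes V :: nat
  assumes infinite_lcosets: "infinite (lcosets R V)"
begin

abbreviation lc :: "nat \<Rightarrow> nat" where
  "lc \<equiv> enumerate (lcosets R V)"

lemma lc_bij: "bij_betw lc UNIV (lcosets R V)"
  using infinite_lcosets by (rule bij_enumerate)

lemma lc_mem: "lc i \<in> lcosets R V"
  using infinite_lcosets by (rule enumerate_in_set)

lemma lc_eq_iff: "lc i = lc j \<longleftrightarrow> i = j"
  using lc_bij by (auto simp: bij_betw_def inj_def)

definition Phi :: "(nat \<Rightarrow> nat) \<Rightarrow> nat \<Rightarrow> nat" where
  "Phi g i = inv_into UNIV lc (act g (lc i))"

lemma lc_Phi: "g \<in> G \<Longrightarrow> lc (Phi g i) = act g (lc i)"
  unfolding Phi_def using act_lcosets[OF lc_mem] by (intro bij_betw_inv_into_right[OF lc_bij]) auto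

lemma Phi_comp: "g \<in> G \<Longrightarrow> h \<in> G \<Longrightarrow> Phi (g \<circ> h) = Phi g \<circ> Phi h"
  by (rule ext, subst lc_eq_iff[symmetric]) (simp add: lc_Phi comp_mem act_comp)

lemma Phi_id: "Phi id = id"
  by (rule ext, subst lc_eq_iff[symmetric]) (simp add: lc_Phi id_mem act_id)

lemma Phi_bij:
  assumes g: "g \<in> G" shows "bij (Phi g)"
proof (rule o_bij)
  show "Phi (pinv g) \<circ> Phi g = id" "Phi g \<circ> Phi (pinv g) = id"
    using bij_mem[OF g] by (simp_all add: Phi_comp[symmetric] g inv_mem Phi_id pinv_comp_left pinv_comp_right
        del: o_apply)
qed

lemma Phi_eq_iff: "g \<in> G \<Longrightarrow> Phi g i = j \<longleftrightarrow> act g (lc i) = lc j"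
  by (metis lc_Phi lc_eq_iff)

lemma lc_moves_iff: "lc_moves R V c x y \<longleftrightarrow> (\<forall>g\<in>F c. map (Phi g) x = y)"
proof -
  have "R c (lc i) (lc j) \<longleftrightarrow> (\<forall>g\<in>F c. Phi g i = j)" for i j
    using R_iff_act[OF lc_mem lc_mem] Phi_eq_iff F_mem by blast
  then show ?thesis
    unfolding lc_moves_def using list_all2_map_eq_iff[OF open_coset_nonempty[OF F_coset]] by simp
qed

lemma Phi_continuous: "\<exists>r. \<forall>g\<in>G. \<forall>h\<in>G. map g r = map h r \<longrightarrow> map (Phi g) x = map (Phi h) x"
proof (rule uniform_on_lists)
  fix i
  show "\<exists>r. \<forall>g\<in>G. \<forall>h\<in>G. map g r = map h r \<longrightarrow> Phi g i = Phi h i"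
    using act_continuous[of "lc i"] unfolding Phi_def by metis
qed

text \<open>By continuity, any open coset around \<open>g\<close> shrinks to one on which the images
  of \<open>x\<close> are constant. This converts statements about one group element into statements
  about an element of the structure.\<close>

lemma ex_lc_moves:
  assumes A: "open_coset G A" and g: "g \<in> A"
  shows "\<exists>c. g \<in> F c \<and> F c \<subseteq> A \<and> lc_moves R V c x (map (Phi g) x)"
proof -
  note gG = open_coset_subset[OF A g]
  obtain r where r: "\<forall>g\<in>G. \<forall>h\<in>G. map g r = map h r \<longrightarrow> map (Phi g) x = map (Phi h) x"
    using Phi_continuous by blast
  have "open_coset G (A \<inter> {h\<in>G. map h r = map g r})"
    using g gG by (intro open_coset_Int[OF A open_coset_mapsto[OF trI[OF gG]], of g]) auto
  then obtain c where c: "F c = A \<inter> {h\<in>G. map h r = map g r}" using F_surj by blast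
  have "map (Phi h) x = map (Phi g) x" if "h \<in> F c" for h
    using r gG that c by blast
  then show ?thesis
    using g gG c unfolding lc_moves_iff by blast
qed

lemma action_tr_eq: "action_tr R V = tr (Phi ` G)"
proof (intro ext iffI)
  fix x y assume "action_tr R V x y"
  then obtain c where c: "\<forall>g\<in>F c. map (Phi g) x = y" by (auto simp: action_tr_def lc_moves_iff)
  obtain g where "g \<in> F c" using F_nonempty by blast
  then show "tr (Phi ` G) x y" using c F_mem unfolding tr_def by blast
next
  fix x y assume "tr (Phi ` G) x y"
  then obtain g where "g \<in> G" "map (Phi g) x = y" by (auto simp: tr_def)
  then show "action_tr R V x y" using ex_lc_moves[OF open_coset_self] unfolding action_tr_def by blast
qed

lemma canon_tr_eq: "canon_tr R V a = tr (Phi ` F a)"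
proof (intro ext iffI)
  fix x y assume "canon_tr R V a x y"
  then obtain c where c: "\<forall>g\<in>F c. map (Phi g) x = y" "F c \<subseteq> F a"
    by (auto simp: canon_tr_def lc_moves_iff coset_le_iff)
  obtain g where "g \<in> F c" using F_nonempty by blast
  then show "tr (Phi ` F a) x y" using c unfolding tr_def by blast
next
  fix x y assume "tr (Phi ` F a) x y"
  then obtain g where "g \<in> F a" "map (Phi g) x = y" by (auto simp: tr_def)
  then show "canon_tr R V a x y"
    using ex_lc_moves[OF F_coset] unfolding canon_tr_def coset_le_iff by blast
qed

lemma orbit_system_action_tr: "orbit_system (action_tr R V)"
proof -
  have "perm_group (Phi ` G)"
  proof
    show "bij g" if "g \<in> Phi ` G" for g using that Phi_bij by blast
    show "id \<in> Phi ` G" using Phi_id id_mem by (metis imageI)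
    show "g \<circ> h \<in> Phi ` G" if "g \<in> Phi ` G" "h \<in> Phi ` G" for g h
      using that comp_mem by (auto simp: Phi_comp[symmetric])
    show "pinv g \<in> Phi ` G" if gPhi: "g \<in> Phi ` G" for g
    proof -
      obtain h where h: "h \<in> G" "g = Phi h" using gPhi by blast
      have "pinv g = Phi (pinv h)"
        unfolding h(2) using hom_pinv[of G Phi h] Phi_bij Phi_comp h(1) closed_group_axioms by metis
      then show ?thesis using inv_mem[OF h(1)] by blast
    qed
  qed
  then show ?thesis unfolding action_tr_eq by (rule perm_group.orbit_system_tr)
qed

text \<open>Apply the last clause of \<open>good\<close> to the stabiliser of \<open>r\<close>: some
  nonempty set of all \<open>k\<close> acting as \<open>x\<close> to \<open>y\<close> lies inside
  it. If \<open>g\<close> and \<open>h\<close> act alike on \<open>x\<close>, then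
  \<open>u = pinv h \<circ> g\<close> fixes \<open>x\<close>, so \<open>k\<close> and
  \<open>k \<circ> u\<close> both lie in that set and both fix \<open>r\<close>; hence
  \<open>u\<close> fixes \<open>r\<close>.\<close>

lemma good_continuous_inv:
  assumes good: "good R V"
  shows "\<exists>x. \<forall>g\<in>G. \<forall>h\<in>G. map (Phi g) x = map (Phi h) x \<longrightarrow> map g r = map h r"
proof -
  have "open_coset G {g\<in>G. map g r = r}"
    using open_coset_mapsto[OF trI[OF id_mem, of r]] by simp
  then obtain c where c: "F c = {g\<in>G. map g r = r}" using F_surj by blast
  obtain x y where xy: "action_tr R V x y" and d: "\<And>d. lc_moves R V d x y \<Longrightarrow> F d \<subseteq> F c"
    using good unfolding good_def coset_le_iff by metis
  obtain k where k: "k \<in> G" "map (Phi k) x = y" using xy by (auto simp: action_tr_eq tr_def)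
  have mem: "h \<in> F c" if h: "h \<in> G" "map (Phi h) x = y" for h
    using ex_lc_moves[OF open_coset_self h(1), of x] d h(2) by blast
  show ?thesis
  proof (intro exI[of _ x] ballI impI)
    fix g h assume gh: "g \<in> G" "h \<in> G" "map (Phi g) x = map (Phi h) x"
    define u where "u = pinv h \<circ> g"
    have u: "u \<in> G" using gh comp_mem inv_mem by (simp add: u_def)
    have "h \<circ> u = g" using bij_mem[OF gh(2)] by (simp add: u_def fun_eq_iff)
    then have "map (Phi h) (map (Phi u) x) = map (Phi h) x"
      using Phi_comp[OF gh(2) u] gh(3) by simp
    then have ux: "map (Phi u) x = x"
      using Phi_bij[OF gh(2)] by (metis map_eq_iff_map_pinv)
    have "k \<circ> u \<in> F c"
      using mem[OF comp_mem[OF k(1) u]] ux k(2) Phi_comp[OF k(1) u] by (metis map_map)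
    then have "map k (map u r) = r" using c by simp
    moreover have "map k r = r" using mem[OF k] c by simp
    ultimately have "map u r = r" using bij_mem[OF k(1)] by (metis map_eq_iff_map_pinv)
    then show "map g r = map h r" unfolding u_def using map_eq_pinv_comp[OF bij_mem[OF gh(2)]] by blast
  qed
qed

lemma good_tgi:
  assumes good: "good R V"
  shows "pset (action_tr R V) = Phi ` G" "tgi G (Phi ` G) Phi"
  using tgi_closed_image[of G Phi, OF closed_group_axioms Phi_bij Phi_comp Phi_continuous
      good_continuous_inv[OF good]]
  by (simp_all add: action_tr_eq)

text \<open>The image group \<open>H\<close> has two numberings of its open cosets, one transported
  from \<open>F\<close> and one from the enumeration of codes. Open cosets are closed, so equality
  of traces is equality of cosets, and \<open>matches\<close> compares the two numberings.\<close>

lemma good_canonical: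
  assumes good: "good R V"
  shows "canonical R V"
proof -
  define H where "H = Phi ` G"
  define T where "T = action_tr R V"
  note tgi = good_tgi(2)[OF good, folded H_def]
  have H: "H = pset T" using good_tgi(1)[OF good] by (simp add: H_def T_def)
  have orb: "orbit_system T" "finite_reps T" using good unfolding good_def T_def by blast+
  then interpret H: oligo_group H unfolding H by (rule oligo_group_pset)
  have trH: "tr H = T" unfolding H by (rule tr_pset[OF orb(1)])
  define F' where "F' k = pset (coset_tr T k)" for k
  have F': "presents (coset_rel T) H F'"
    using H.presents_coset_rel by (simp add: trH F'_def[abs_def])
  have bijF': "bij_betw F' UNIV {A. open_coset H A}" using F' by (simp add: presents_def)
  have cosH: "open_coset H (Phi ` F a)" for a
    by (rule open_coset_image[OF tgi closed_group_axioms H.closed_group_axioms F_coset])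
  have m: "matches R V a k \<longleftrightarrow> Phi ` F a = F' k" for a k
  proof -
    have "matches R V a k \<longleftrightarrow> tr (Phi ` F a) = coset_tr T k"
      unfolding matches_def canon_tr_eq T_def fun_eq_iff by (rule refl)
    also have "\<dots> \<longleftrightarrow> Phi ` F a = F' k"
    proof
      assume "tr (Phi ` F a) = coset_tr T k"
      then show "Phi ` F a = F' k" using H.open_coset_closed[OF cosH] by (metis F'_def)
    next
      assume "Phi ` F a = F' k"
      then show "tr (Phi ` F a) = coset_tr T k" using H.tr_pset_coset_tr[of k] by (simp add: F'_def trH)
    qed
    finally show ?thesis .
  qed
  have bij: "bij_betw (\<lambda>a. Phi ` F a) UNIV {A. open_coset H A}"
    using bij_betw_trans[OF F_bij bij_betw_open_cosets[OF tgi closed_group_axioms H.closed_group_axioms]]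
    by (simp add: comp_def)
  show ?thesis
    unfolding canonical_def m T_def[symmetric]
  proof (intro conjI allI impI)
    show "\<exists>k. Phi ` F a = F' k" for a
      using cosH bij_betw_inv_into_right[OF bijF'] by (metis mem_Collect_eq)
    show "\<exists>a. Phi ` F a = F' k" for k
      using bij_betw_inv_into_right[OF bij] bij_betw_apply[OF bijF'] by (metis UNIV_I)
    show "a = b" if "Phi ` F a = F' k" "Phi ` F b = F' k" for a b k
      using that bij by (auto simp: bij_betw_def inj_def)
    show "R a b c \<longleftrightarrow> coset_rel T k l m"
      if "Phi ` F a = F' k" "Phi ` F b = F' l" "Phi ` F c = F' m" for a b c k l m
    proof -
      have "coset_rel T k l m \<longleftrightarrow> prod_sub (F' k) (F' l) (F' m)" using F' by (simp add: presents_def)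
      also have "\<dots> \<longleftrightarrow> prod_sub (F a) (F b) (F c)"
        unfolding that[symmetric] using F_mem
        by (intro prod_sub_image[OF tgi closed_group_axioms]) auto
      finally show ?thesis by (simp add: R_iff)
    qed
  qed
qed

end

lemma infinite_lcosets_if_good: "good R V \<Longrightarrow> infinite (lcosets R V)"
  by (simp add: good_def infinite_nat_iff_unbounded)

lemma (in presentation) good_recovers:
  assumes good: "good R V"
  shows "\<exists>\<phi>. tgi G (pset (action_tr R V)) \<phi>" and "canonical R V"
proof -
  interpret lcoset_action G R F V
    using infinite_lcosets_if_good[OF good] by unfold_locales
  show "\<exists>\<phi>. tgi G (pset (action_tr R V)) \<phi>" using good_tgi[OF good] by auto
  show "canonical R V" by (rule good_canonical[OF good])
qed

section \<open>Existence of a suitable \<open>V\<close>\<close>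

lemma (in oligo_group) ex_base: "\<exists>r. \<forall>a. \<exists>i\<in>set r. tr G [i] [a]"
proof -
  obtain zs where zs: "\<And>x. length x = 1 \<Longrightarrow> \<exists>z\<in>set zs. tr G z x"
    using finite_reps_obtain by blast
  have "\<exists>i\<in>set (map hd zs). tr G [i] [a]" for a
  proof -
    obtain z where z: "z \<in> set zs" "tr G z [a]" using zs[of "[a]"] by auto
    have "z = [hd z]" using tr_length[OF z(2)] by (cases z) auto
    then show ?thesis using z by (metis image_eqI list.set_map)
  qed
  then show ?thesis by blast
qed

text \<open>The stabiliser of a tuple meeting every orbit on points is a suitable \<open>V\<close>: a left coset of it
  is determined by the image of the tuple.\<close>

lemma (in presentation) ex_good: "\<exists>V. good R V"
proof -
  obtain r where base: "\<And>a. \<exists>i\<in>set r. tr G [i] [a]" using ex_base by blast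
  have "open_coset G {g\<in>G. map g r = r}"
    using open_coset_mapsto[OF trI[OF id_mem, of r]] by simp
  then obtain V where V: "F V = {g\<in>G. map g r = r}" using F_surj by blast
  have ex_lcoset: "\<exists>c\<in>lcosets R V. F c = {g\<in>G. map g r = y}" if y: "tr G r y" for y
  proof -
    obtain c where c: "F c = {g\<in>G. map g r = y}" using F_surj[OF open_coset_mapsto[OF y]] by blast
    obtain d where d: "F d = {g\<in>G. map g y = r}"
      using F_surj[OF open_coset_mapsto[OF orbit_system_sym[OF orbit_system_tr y]]] by blast
    have "prod_sub (F c) (F V) (F c)"
      unfolding prod_sub_def c V by (auto intro: comp_mem simp flip: map_map)
    moreover have "prod_sub (F d) (F c) (F V)"
      unfolding prod_sub_def c d V by (auto intro: comp_mem simp flip: map_map)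
    ultimately have "c \<in> lcosets R V" by (auto simp: lcosets_def R_iff)
    then show ?thesis using c by blast
  qed
  have lcoset_eq: "F a = {h\<in>G. map h r = map g r}" if a: "a \<in> lcosets R V" and g: "g \<in> F a" for a g
  proof
    obtain d where d: "prod_sub (F a) (F V) (F a)" "prod_sub (F d) (F a) (F V)"
      using a by (auto simp: lcosets_def R_iff)
    have gG: "g \<in> G" by (rule F_mem[OF g])
    show "{h\<in>G. map h r = map g r} \<subseteq> F a"
    proof
      fix h assume h: "h \<in> {h\<in>G. map h r = map g r}"
      then have "map (pinv g \<circ> h) r = r" using map_eq_pinv_comp[OF bij_mem[OF gG]] by blast
      then have "pinv g \<circ> h \<in> F V" using h V comp_mem[OF inv_mem[OF gG]] by blast
      then have "g \<circ> (pinv g \<circ> h) \<in> F a" using d(1) g unfolding prod_sub_def by blast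
      moreover have "g \<circ> (pinv g \<circ> h) = h" using bij_mem[OF gG] by (simp add: fun_eq_iff)
      ultimately show "h \<in> F a" by simp
    qed
    show "F a \<subseteq> {h\<in>G. map h r = map g r}"
    proof
      fix h assume h: "h \<in> F a"
      obtain d0 where d0: "d0 \<in> F d" using F_nonempty by blast
      have "d0 \<circ> h \<in> F V" "d0 \<circ> g \<in> F V" using d(2) d0 h g unfolding prod_sub_def by blast+
      then have "map d0 (map h r) = map d0 (map g r)" using V by (simp del: map_eq_conv)
      then have "map h r = map g r" using bij_mem[OF F_mem[OF d0]] by (metis map_eq_iff_map_pinv)
      then show "h \<in> {h\<in>G. map h r = map g r}" using F_mem[OF h] by blast
    qed
  qed
  \<comment> \<open>Each left coset has one image tuple of \<open>r\<close>, and every point occurs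
    in such a tuple because \<open>r\<close> meets every orbit.\<close>
  have "infinite (lcosets R V)"
  proof
    assume fin: "finite (lcosets R V)"
    define Y where "Y a = map (SOME g. g \<in> F a) r" for a
    have "(UNIV :: nat set) \<subseteq> (\<Union>a\<in>lcosets R V. set (Y a))"
    proof
      fix b :: nat
      obtain i g where i: "i \<in> set r" "g \<in> G" "g i = b" using base[of b] by (auto simp: tr_def)
      obtain c where c: "c \<in> lcosets R V" "F c = {h\<in>G. map h r = map g r}"
        using ex_lcoset[OF trI[OF i(2)]] by blast
      have "(SOME g. g \<in> F c) \<in> F c" by (rule someI_ex[OF F_nonempty])
      then have "Y c = map g r" unfolding Y_def using c(2) by blast
      then have "b \<in> set (Y c)" using i by auto
      then show "b \<in> (\<Union>a\<in>lcosets R V. set (Y a))" using c(1) by blast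
    qed
    moreover have "finite (\<Union>a\<in>lcosets R V. set (Y a))" using fin by simp
    ultimately have "finite (UNIV :: nat set)" by (rule finite_subset)
    then show False by simp
  qed
  then interpret lcoset_action G R F V by unfold_locales
  \<comment> \<open>The tuple \<open>Y j\<close> is the common image of \<open>r\<close> under the
    members of the left coset with number \<open>j\<close>; moving left cosets thus becomes moving
    these tuples.\<close>
  define Y where "Y j = map (SOME g. g \<in> F (lc j)) r" for j
  have F_lc: "F (lc j) = {h\<in>G. map h r = Y j}" for j
    unfolding Y_def by (rule lcoset_eq[OF lc_mem someI_ex[OF F_nonempty]])
  have Phi_Y: "Phi h i = j" if h: "h \<in> G" and eq: "map h (Y i) = Y j" for h i j
  proof -
    have "(\<circ>) h ` F (lc i) \<subseteq> F (lc j)"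
      unfolding F_lc using comp_mem[OF h] eq by (auto simp flip: map_map)
    then have "F (act h (lc i)) = F (lc j)"
      using lcosets_translate_eq[OF lc_mem lc_mem h] F_act[OF h] by simp
    then show ?thesis using Phi_eq_iff[OF h] F_eq_iff by blast
  qed
  have "finite_reps (action_tr R V)"
    unfolding finite_reps_def
  proof
    fix n
    \<comment> \<open>A tuple of \<open>n\<close> left cosets is replaced by the concatenation of
      its image tuples, so finiteness follows from the finitely many orbits of \<open>G\<close> on
      tuples of length \<open>n * length r\<close>.\<close>
    define C where "C x = concat (map Y x)" for x
    have lenC: "length (C x) = n * length r" if "length x = n" for x
      using that by (induction x arbitrary: n) (auto simp: C_def Y_def)
    obtain zs where zs: "\<And>u. length u = n * length r \<Longrightarrow> \<exists>z\<in>set zs. tr G z u"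
      using finite_reps_obtain by blast
    \<comment> \<open>Orbit representatives need not be concatenations; \<open>f\<close> picks an
      index tuple whose concatenation lies in the orbit of \<open>z\<close>, if there is
      one.\<close>
    define f where "f z = (SOME x. length x = n \<and> tr G z (C x))" for z
    have "\<exists>z\<in>set (map f zs). action_tr R V z x" if x: "length x = n" for x
    proof -
      obtain z where z: "z \<in> set zs" "tr G z (C x)" using zs[OF lenC[OF x]] by blast
      have "\<exists>x. length x = n \<and> tr G z (C x)" using x z(2) by blast
      then have f: "length (f z) = n" "tr G z (C (f z))" unfolding f_def by (rule someI2_ex; blast)+
      have "tr G (C (f z)) (C x)"
        using orbit_system_trans[OF orbit_system_tr orbit_system_sym[OF orbit_system_tr f(2)] z(2)] .
      then obtain h where h: "h \<in> G" "map h (C (f z)) = C x" by (auto simp: tr_def simp del: map_eq_conv)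
      have "concat (map (map h) (map Y (f z))) = concat (map Y x)"
        using h(2) by (simp add: C_def map_concat del: map_map)
      \<comment> \<open>All blocks have the length of \<open>r\<close>, so equal concatenations have
        equal blocks.\<close>
      then have "map (map h) (map Y (f z)) = map Y x"
        by (subst (asm) concat_eq_concat_iff) (auto simp: f(1) x Y_def set_zip simp del: map_map)
      then have Ys: "map (\<lambda>i. map h (Y i)) (f z) = map Y x" by (simp add: comp_def)
      have "map (Phi h) (f z) = x"
      proof (rule nth_equalityI)
        fix i assume "i < length (map (Phi h) (f z))"
        then have i: "i < n" using f(1) by simp
        have "map h (Y (f z ! i)) = Y (x ! i)" using arg_cong[OF Ys, of "\<lambda>l. l ! i"] i f(1) x by simp
        then show "map (Phi h) (f z) ! i = x ! i" using Phi_Y[OF h(1)] i f(1) by simp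
      qed (simp add: f(1) x)
      then have "action_tr R V (f z) x" unfolding action_tr_eq tr_def using h(1) by blast
      then show ?thesis using z(1) by auto
    qed
    then show "\<exists>zs. \<forall>x. length x = n \<longrightarrow> (\<exists>z\<in>set zs. action_tr R V z x)" by blast
  qed
  moreover have "\<exists>x y. action_tr R V x y \<and> (\<forall>d. lc_moves R V d x y \<longrightarrow> coset_le R d c)" for c
  proof -
    obtain p where p: "p \<in> F c" using F_nonempty by blast
    obtain s where s: "\<And>a g. a \<in> F c \<Longrightarrow> g \<in> G \<Longrightarrow> map g s = map a s \<Longrightarrow> g \<in> F c"
      using open_coset_open[OF F_coset] by metis
    \<comment> \<open>All members of the left coset with number \<open>j\<close> take one entry
      \<open>i\<close> of \<open>r\<close> to \<open>a\<close>. Where \<open>h\<close> moves this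
      coset therefore determines the value of \<open>h\<close> at \<open>a\<close>.\<close>
    have "\<exists>j. \<exists>i\<in>set r. \<exists>g\<in>G. g i = a \<and> F (lc j) = {h\<in>G. map h r = map g r}" for a
    proof -
      obtain i g where i: "i \<in> set r" "g \<in> G" "g i = a" using base[of a] by (auto simp: tr_def)
      obtain c where c: "c \<in> lcosets R V" "F c = {h\<in>G. map h r = map g r}"
        using ex_lcoset[OF trI[OF i(2)]] by blast
      have "lc (inv_into UNIV lc c) = c" by (rule bij_betw_inv_into_right[OF lc_bij c(1)])
      then have "F (lc (inv_into UNIV lc c)) = {h\<in>G. map h r = map g r}" using c(2) by simp
      then show ?thesis using i by blast
    qed
    then have "\<forall>a. \<exists>j. \<exists>i\<in>set r. \<exists>g\<in>G. g i = a \<and> F (lc j) = {h\<in>G. map h r = map g r}"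
      by (rule allI)
    from choice[OF this] obtain j where
      j: "\<And>a. \<exists>i\<in>set r. \<exists>g\<in>G. g i = a \<and> F (lc (j a)) = {h\<in>G. map h r = map g r}"
      by blast
    define x where "x = map j s"
    have "action_tr R V x (map (Phi p) x)"
      unfolding action_tr_eq using F_mem[OF p] trI by blast
    moreover have "F d \<subseteq> F c" if d: "lc_moves R V d x (map (Phi p) x)" for d
    proof
      fix h assume h: "h \<in> F d"
      then have "map (Phi h) x = map (Phi p) x" using d by (simp add: lc_moves_iff)
      then have Phi_eq: "Phi h (j a) = Phi p (j a)" if "a \<in> set s" for a using that by (simp add: x_def)
      have "h a = p a" if a: "a \<in> set s" for a
      proof -
        obtain i g where ig: "i \<in> set r" "g \<in> G" "g i = a" "F (lc (j a)) = {h\<in>G. map h r = map g r}"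
          using j[of a] by blast
        have "act h (lc (j a)) = act p (lc (j a))"
          using Phi_eq[OF a] lc_Phi[OF F_mem[OF h], of "j a"] lc_Phi[OF F_mem[OF p], of "j a"] by simp
        then have "(\<circ>) h ` F (lc (j a)) = (\<circ>) p ` F (lc (j a))"
          using F_act[OF F_mem[OF h], of "lc (j a)"] F_act[OF F_mem[OF p], of "lc (j a)"] by simp
        moreover have "g \<in> F (lc (j a))" using ig by simp
        ultimately obtain k where k: "k \<in> F (lc (j a))" "h \<circ> g = p \<circ> k" by blast
        have "map k r = map g r" using k(1) ig(4) by blast
        then have "k i = a" using ig by simp
        moreover have "h (g i) = p (k i)" using k(2) by (metis o_apply)
        ultimately show ?thesis using ig(3) by simp
      qed
      then have "map h s = map p s" by simp
      then show "h \<in> F c" using s[OF p F_mem[OF h]] by blast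
    qed
    ultimately show ?thesis unfolding coset_le_iff by blast
  qed
  ultimately have "good R V"
    unfolding good_def using orbit_system_action_tr infinite_lcosets[unfolded infinite_nat_iff_unbounded]
    by blast
  then show ?thesis by blast
qed

section \<open>From structures back to groups\<close>

definition codes_group :: "(nat \<Rightarrow> nat \<Rightarrow> nat \<Rightarrow> bool) \<Rightarrow> nat \<Rightarrow> bool" where
  "codes_group R V \<longleftrightarrow> good R V \<and> canonical R V"

lemma presents_codes_group:
  assumes "oligo_group G" "presents R G F"
  shows "\<exists>V. codes_group R V" and "codes_group R V \<Longrightarrow> \<exists>\<phi>. tgi G (pset (action_tr R V)) \<phi>"
proof -
  interpret presentation G R F using assms by (simp add: presentation_def presentation_axioms_def)
  show "\<exists>V. codes_group R V" using ex_good good_recovers(2) unfolding codes_group_def by blast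
  show "codes_group R V \<Longrightarrow> \<exists>\<phi>. tgi G (pset (action_tr R V)) \<phi>"
    using good_recovers(1) unfolding codes_group_def by blast
qed

lemma oligo_group_action_tr: "codes_group R V \<Longrightarrow> oligo_group (pset (action_tr R V))"
  unfolding codes_group_def good_def by (elim conjE) (rule oligo_group_pset)

text \<open>No presented group is given in advance; \<open>canonical\<close> supplies the numbering.
  The map \<open>f\<close> from each \<open>a\<close> to a matching \<open>k\<close> is an
  isomorphism onto the coset structure of the rebuilt group.\<close>

lemma codes_group_presents:
  assumes "codes_group R V"
  shows "\<exists>F. presents R (pset (action_tr R V)) F"
proof -
  define T where "T = action_tr R V"
  interpret oligo_group "pset T" unfolding T_def by (rule oligo_group_action_tr[OF assms])
  have orb: "orbit_system T" using assms unfolding codes_group_def good_def T_def by blast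
  define F where "F k = pset (coset_tr T k)" for k
  have F: "presents (coset_rel T) (pset T) F"
    using presents_coset_rel unfolding tr_pset[OF orb] F_def .
  have can: "canonical R V" using assms by (simp add: codes_group_def)
  obtain f where f: "\<And>a. matches R V a (f a)" using can unfolding canonical_def by metis
  have "bij f"
  proof (rule bijI)
    show "inj f" by (rule injI) (metis can canonical_def f)
    show "surj f"
    proof (rule surjI)
      fix k
      define a where "a = (SOME a. matches R V a k)"
      have a: "matches R V a k" unfolding a_def using can by (metis canonical_def someI_ex)
      \<comment> \<open>Two numbers matched with the same \<open>a\<close> have the same trace,
        hence name the same coset, and the numbering is injective.\<close>
      then have "coset_tr T (f a) = coset_tr T k"
        using f[of a] unfolding matches_def T_def fun_eq_iff by blast
      then have "F (f a) = F k" by (simp add: F_def)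
      moreover have "inj F" using F by (auto simp: presents_def bij_betw_def)
      ultimately show "f a = k" by (simp add: inj_eq)
    qed
  qed
  moreover have "R a b c \<longleftrightarrow> coset_rel T (f a) (f b) (f c)" for a b c
  proof -
    have "\<forall>a b c k l m. matches R V a k \<longrightarrow> matches R V b l \<longrightarrow> matches R V c m \<longrightarrow>
        (R a b c \<longleftrightarrow> coset_rel T k l m)"
      using can unfolding canonical_def T_def by (elim conjE)
    then show ?thesis using f by blast
  qed
  ultimately have "presents R (pset T) (F \<circ> f)" by (rule presents_reindex[OF F])
  then show ?thesis unfolding T_def by blast
qed

lemma presents_iso_tgi:
  assumes G: "oligo_group G" and H: "oligo_group H"
    and R: "presents R G F" and R': "presents R' H F'"
    and f: "bij f" "\<And>a b c. R a b c \<longleftrightarrow> R' (f a) (f b) (f c)"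
  shows "\<exists>\<phi>. tgi G H \<phi>"
proof -
  have RH: "presents R H (F' \<circ> f)" by (rule presents_reindex[OF R' f])
  obtain V where V: "codes_group R V" using presents_codes_group(1)[OF G R] by blast
  obtain \<phi> where \<phi>: "tgi G (pset (action_tr R V)) \<phi>" using presents_codes_group(2)[OF G R V] by blast
  obtain \<psi> where \<psi>: "tgi H (pset (action_tr R V)) \<psi>" using presents_codes_group(2)[OF H RH V] by blast
  have "closed_group H" using H by (simp add: oligo_group_def)
  from tgi_trans[OF \<phi> tgi_sym[OF \<psi> this]] show ?thesis by blast
qed

section \<open>Measurability\<close>

text \<open>Element \<open>k + 1\<close> of a set is element \<open>k\<close> of the set without its
  least member. \<open>LEAST\<close> is a total function, so finite sets need no separate
  case.\<close>

lemma measurable_enumerate: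
  fixes P :: "'a \<Rightarrow> nat \<Rightarrow> bool"
  assumes "\<And>j. Measurable.pred M (\<lambda>w. P w j)"
  shows "(\<lambda>w. enumerate {j. P w j} k) \<in> M \<rightarrow>\<^sub>M count_space UNIV"
  using assms
proof (induction k arbitrary: P)
  case 0
  have "(\<lambda>w. LEAST j. P w j) \<in> M \<rightarrow>\<^sub>M count_space UNIV" by (rule measurable_Least) (rule 0)
  then show ?case by (simp add: enumerate_0)
next
  case (Suc k)
  note [measurable] = Suc.prems
  have [measurable]: "(\<lambda>w. LEAST j. P w j) \<in> M \<rightarrow>\<^sub>M count_space UNIV"
    by (rule measurable_Least) (rule Suc.prems)
  have "(\<lambda>w. enumerate {j. P w j \<and> (LEAST j. P w j) \<noteq> j} k) \<in> M \<rightarrow>\<^sub>M count_space UNIV"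
    by (rule Suc.IH) measurable
  moreover have "{j. P w j} - {LEAST j. P w j} = {j. P w j \<and> (LEAST j. P w j) \<noteq> j}" for w
    by auto
  ultimately show ?case by (simp add: enumerate_Suc)
qed

lemma pred_at_measurable_nat:
  fixes f :: "'a \<Rightarrow> nat"
  assumes "\<And>j. Measurable.pred M (\<lambda>w. Q w j)" "f \<in> M \<rightarrow>\<^sub>M count_space UNIV"
  shows "Measurable.pred M (\<lambda>w. Q w (f w))"
  using measurable_compose_countable[of "\<lambda>j w. Q w j", OF assms] .

section \<open>Borel conditions on traces\<close>

context
  fixes M :: "'a measure" and T :: "'a \<Rightarrow> nat list \<Rightarrow> nat list \<Rightarrow> bool"
  assumes T [measurable]: "\<And>x y. Measurable.pred M (\<lambda>w. T w x y)"
begin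

lemma pred_orbit_system: "Measurable.pred M (\<lambda>w. orbit_system (T w))"
  unfolding orbit_system_def by measurable

lemma pred_finite_reps: "Measurable.pred M (\<lambda>w. finite_reps (T w))"
  unfolding finite_reps_def by measurable

lemma pred_dcode [measurable]: "Measurable.pred M (\<lambda>w. dcode (T w) c x y)"
  by (cases c) (simp only: dcode.simps, measurable)

lemma pred_valid_code [measurable]: "Measurable.pred M (\<lambda>w. valid_code (T w) j)"
  unfolding valid_code_def by measurable

lemma pred_coset_tr [measurable]: "Measurable.pred M (\<lambda>w. coset_tr (T w) k x y)"
  unfolding coset_tr_def
  by (rule pred_at_measurable_nat[where Q = "\<lambda>w j. dcode (T w) (from_nat j) x y"])
    (measurable, rule measurable_enumerate, measurable)

lemma pred_coset_rel: "Measurable.pred M (\<lambda>w. coset_rel (T w) k l m)"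
  unfolding coset_rel_def by measurable

end

section \<open>Borel conditions on ternary relations\<close>

context
  fixes M :: "'a measure" and R :: "'a \<Rightarrow> nat \<Rightarrow> nat \<Rightarrow> nat \<Rightarrow> bool"
  assumes R [measurable]: "\<And>a b c. Measurable.pred M (\<lambda>w. R w a b c)"
begin

lemma pred_lcosets [measurable]: "Measurable.pred M (\<lambda>w. c \<in> lcosets (R w) V)"
  unfolding lcosets_def mem_Collect_eq by measurable

lemma measurable_enumerate_lcosets:
  "(\<lambda>w. enumerate (lcosets (R w) V) i) \<in> M \<rightarrow>\<^sub>M count_space UNIV"
  using measurable_enumerate[where M = M and P = "\<lambda>w c. c \<in> lcosets (R w) V" and k = i] pred_lcosets by simp

lemma pred_lc_moves [measurable]: "Measurable.pred M (\<lambda>w. lc_moves (R w) V c x y)"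
proof -
  have "Measurable.pred M (\<lambda>w. R w c (enumerate (lcosets (R w) V) i) (enumerate (lcosets (R w) V) j))" for i j
    by (rule pred_at_measurable_nat[OF _ measurable_enumerate_lcosets],
        rule pred_at_measurable_nat[OF _ measurable_enumerate_lcosets]) measurable
  note [measurable] = this
  show ?thesis unfolding lc_moves_def list_all2_conv_all_nth by measurable
qed

lemma pred_action_tr [measurable]: "Measurable.pred M (\<lambda>w. action_tr (R w) V x y)"
  unfolding action_tr_def by measurable

lemma pred_coset_le [measurable]: "Measurable.pred M (\<lambda>w. coset_le (R w) c a)"
  unfolding coset_le_def by measurable

lemma pred_canon_tr [measurable]: "Measurable.pred M (\<lambda>w. canon_tr (R w) V a x y)"
  unfolding canon_tr_def by measurable

lemma pred_good [measurable]: "Measurable.pred M (\<lambda>w. good (R w) V)"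
proof -
  note [measurable] = pred_orbit_system[OF pred_action_tr] pred_finite_reps[OF pred_action_tr]
  show ?thesis unfolding good_def by measurable
qed

lemma pred_matches [measurable]: "Measurable.pred M (\<lambda>w. matches (R w) V a k)"
proof -
  note [measurable] = pred_coset_tr[OF pred_action_tr]
  show ?thesis unfolding matches_def by measurable
qed

lemma pred_canonical [measurable]: "Measurable.pred M (\<lambda>w. canonical (R w) V)"
proof -
  note [measurable] = pred_coset_rel[OF pred_action_tr]
  show ?thesis unfolding canonical_def by measurable
qed

lemma pred_codes_group: "Measurable.pred M (\<lambda>w. codes_group (R w) V)"
  unfolding codes_group_def by measurable

end

section \<open>The Effros Borel space in terms of traces\<close>

lemma effros_generators_subset:
  "{{D. closedin S_inf_top D \<and> D \<inter> U \<noteq> {}} | U. openin S_inf_top U} \<subseteq> Pow {D. closedin S_inf_top D}"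
  by auto

lemma space_effros: "space effros_S_inf = {D. closedin S_inf_top D}"
  unfolding effros_S_inf_def by (rule space_measure_of[OF effros_generators_subset])

text \<open>The condition says that \<open>D\<close> meets the basic open set of permutations taking
  \<open>x\<close> to \<open>y\<close>, which is a generator of the Effros algebra.\<close>

lemma pred_tr_effros: "Measurable.pred effros_S_inf (\<lambda>D. tr D x y)"
proof -
  define U where "U = {g. bij g \<and> map g x = y}"
  have "openin S_inf_top U"
    unfolding openin_S_inf_top U_def by (auto intro!: exI[of _ x] simp del: map_eq_conv)
  then have "{D. closedin S_inf_top D \<and> D \<inter> U \<noteq> {}} \<in> sets effros_S_inf"
    unfolding effros_S_inf_def sets_measure_of[OF effros_generators_subset]
    by (intro sigma_sets.Basic) blast
  moreover have "{D \<in> space effros_S_inf. tr D x y} = {D. closedin S_inf_top D \<and> D \<inter> U \<noteq> {}}"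
    unfolding space_effros U_def tr_def using closedin_S_inf_top by blast
  ultimately show ?thesis by (simp add: pred_def)
qed

text \<open>An open set is the union of the countably many basic sets inside it, so meeting it is a
  countable disjunction of conditions on the trace.\<close>

lemma measurable_into_effros:
  assumes f: "\<And>w. w \<in> space M \<Longrightarrow> closedin S_inf_top (f w)"
    and pred: "\<And>x y. Measurable.pred M (\<lambda>w. tr (f w) x y)"
  shows "f \<in> M \<rightarrow>\<^sub>M effros_S_inf"
  unfolding effros_S_inf_def
proof (rule measurable_measure_of[OF effros_generators_subset])
  show "f \<in> space M \<rightarrow> {D. closedin S_inf_top D}" using f by blast
  fix X assume "X \<in> {{D. closedin S_inf_top D \<and> D \<inter> U \<noteq> {}} | U. openin S_inf_top U}"
  then obtain U where U: "openin S_inf_top U" and X: "X = {D. closedin S_inf_top D \<and> D \<inter> U \<noteq> {}}" by blast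
  have "f w \<inter> U \<noteq> {} \<longleftrightarrow> (\<exists>x y. (\<forall>g. bij g \<longrightarrow> map g x = y \<longrightarrow> g \<in> U) \<and> tr (f w) x y)"
    if w: "w \<in> space M" for w
  proof
    assume "f w \<inter> U \<noteq> {}"
    then obtain g where g: "g \<in> f w" "g \<in> U" by blast
    obtain x where "\<forall>h. bij h \<longrightarrow> map h x = map g x \<longrightarrow> h \<in> U"
      using U g(2) unfolding openin_S_inf_top by blast
    then show "\<exists>x y. (\<forall>g. bij g \<longrightarrow> map g x = y \<longrightarrow> g \<in> U) \<and> tr (f w) x y"
      using trI[OF g(1), of x] by blast
  next
    assume "\<exists>x y. (\<forall>g. bij g \<longrightarrow> map g x = y \<longrightarrow> g \<in> U) \<and> tr (f w) x y"
    then show "f w \<inter> U \<noteq> {}" using f[OF w] unfolding closedin_S_inf_top tr_def by blast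
  qed
  then have "f -` X \<inter> space M =
      {w \<in> space M. \<exists>x y. (\<forall>g. bij g \<longrightarrow> map g x = y \<longrightarrow> g \<in> U) \<and> tr (f w) x y}"
    using f X by auto
  moreover note [measurable] = pred
  have "{w \<in> space M. \<exists>x y. (\<forall>g. bij g \<longrightarrow> map g x = y \<longrightarrow> g \<in> U) \<and> tr (f w) x y} \<in> sets M"
    by measurable
  ultimately show "f -` X \<inter> space M \<in> sets M" by simp
qed

lemma oligomorphic_groups_Borel: "oligomorphic_groups \<in> sets effros_S_inf"
proof -
  note [measurable] = pred_orbit_system[OF pred_tr_effros] pred_finite_reps[OF pred_tr_effros]
  have "{D \<in> space effros_S_inf. orbit_system (tr D) \<and> finite_reps (tr D)} \<in> sets effros_S_inf"
    by measurable
  then show ?thesis unfolding oligomorphic_groups_eq space_effros by simp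
qed

section \<open>Structures with one ternary relation\<close>

abbreviation tern :: "nat \<Rightarrow> nat" where
  "tern \<equiv> \<lambda>_. 3"

definition rel_of :: "(nat \<Rightarrow> nat list \<Rightarrow> bool) \<Rightarrow> nat \<Rightarrow> nat \<Rightarrow> nat \<Rightarrow> bool" where
  "rel_of M a b c = M 0 [a, b, c]"

text \<open>Both restrictions make the values extensional, as membership in the product spaces
  demands.\<close>

definition str_of :: "(nat \<Rightarrow> nat \<Rightarrow> nat \<Rightarrow> bool) \<Rightarrow> nat \<Rightarrow> nat list \<Rightarrow> bool" where
  "str_of R = (\<lambda>_\<in>{0}. \<lambda>xs\<in>{xs. length xs = 3}. R (xs ! 0) (xs ! 1) (xs ! 2))"

lemma rel_of_str_of [simp]: "rel_of (str_of R) = R"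
  by (auto simp: rel_of_def str_of_def fun_eq_iff)

lemma str_of_structure: "str_of R \<in> structures {0} tern"
  unfolding structures_eq str_of_def by auto

lemma structure_iso_iff:
  "structure_iso {0} tern M N \<longleftrightarrow>
    (\<exists>f. bij f \<and> (\<forall>a b c. rel_of M a b c \<longleftrightarrow> rel_of N (f a) (f b) (f c)))"
proof -
  have "(\<forall>xs. length xs = 3 \<longrightarrow> P xs) \<longleftrightarrow> (\<forall>a b c. P [a, b, c])" for P :: "nat list \<Rightarrow> bool"
    by (auto simp: numeral_3_eq_3 length_Suc_conv)
  then show ?thesis by (simp add: structure_iso_def rel_of_def)
qed

lemma space_borel_of: "space (borel_of X) = topspace X"
  unfolding borel_of_def by (rule space_measure_of) (auto dest: openin_subset)

lemma pred_rel_of: "Measurable.pred (borel_of (structure_top {0} tern)) (\<lambda>M. rel_of M a b c)"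
proof -
  have "continuous_map (structure_top {0} tern) (discrete_topology UNIV) ((\<lambda>r. r [a, b, c]) \<circ> (\<lambda>M. M 0))"
  proof (rule continuous_map_compose)
    let ?X = "product_topology (\<lambda>_. discrete_topology (UNIV :: bool set)) {xs :: nat list. length xs = 3}"
    show "continuous_map (structure_top {0} tern) ?X (\<lambda>M. M 0)"
      unfolding structure_top_def by (rule continuous_map_product_projection) simp
    show "continuous_map ?X (discrete_topology UNIV) (\<lambda>r. r [a, b, c])"
      by (rule continuous_map_product_projection) simp
  qed
  then have "openin (structure_top {0} tern)
      {M \<in> structures {0} tern. ((\<lambda>r. r [a, b, c]) \<circ> (\<lambda>M. M 0)) M \<in> {True}}"
    by (rule openin_continuous_map_preimage) simp
  then have "{M \<in> structures {0} tern. rel_of M a b c} \<in> sets (borel_of (structure_top {0} tern))"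
    unfolding borel_of_def by (subst sets_measure_of)
      (auto simp: rel_of_def dest: openin_subset intro!: sigma_sets.Basic)
  then show ?thesis by (simp add: pred_def space_borel_of)
qed

text \<open>A basic neighbourhood prescribes finitely many truth values. Listing the triples
  required to hold in \<open>p\<close> and those required to fail in \<open>q\<close> puts such
  neighbourhoods into a countable type.\<close>

lemma openin_structure_top_nbhd:
  assumes U: "openin (structure_top {0} tern) U" and M: "M \<in> U"
  shows "\<exists>p q. (\<forall>(a, b, c)\<in>set p. rel_of M a b c) \<and> (\<forall>(a, b, c)\<in>set q. \<not> rel_of M a b c) \<and>
    (\<forall>N\<in>structures {0} tern. (\<forall>(a, b, c)\<in>set p. rel_of N a b c) \<and>
      (\<forall>(a, b, c)\<in>set q. \<not> rel_of N a b c) \<longrightarrow> N \<in> U)"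
proof -
  let ?I = "{xs :: nat list. length xs = 3}"
  obtain X where X: "openin (product_topology (\<lambda>_. discrete_topology (UNIV :: bool set)) ?I) (X (0::nat))"
    "M \<in> Pi\<^sub>E {0} X" "Pi\<^sub>E {0} X \<subseteq> U"
    using U M unfolding structure_top_def openin_product_topology_alt[of _ "{0}"] by force
  have "M 0 \<in> X 0" using X(2) by auto
  then obtain Y where Y: "finite {i \<in> ?I. Y i \<noteq> UNIV}" "M 0 \<in> Pi\<^sub>E ?I Y" "Pi\<^sub>E ?I Y \<subseteq> X 0"
    using X(1) unfolding openin_product_topology_alt by fastforce
  define S where "S = {(a, b, c). Y [a, b, c] \<noteq> UNIV}"
  have "finite S"
  proof (rule finite_imageD)
    show "finite ((\<lambda>(a, b, c). [a, b, c]) ` S)"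
      by (rule finite_subset[OF _ Y(1)]) (auto simp: S_def)
    show "inj_on (\<lambda>(a, b, c). [a, b, c]) S" by (auto simp: inj_on_def)
  qed
  then have "finite {(a, b, c) \<in> S. rel_of M a b c}" "finite {(a, b, c) \<in> S. \<not> rel_of M a b c}"
    by (auto elim!: rev_finite_subset)
  from finite_list[OF this(1)] finite_list[OF this(2)]
  obtain p q where p: "set p = {(a, b, c) \<in> S. rel_of M a b c}"
    and q: "set q = {(a, b, c) \<in> S. \<not> rel_of M a b c}" by auto
  have "N \<in> U" if N: "N \<in> structures {0} tern" "\<forall>(a, b, c)\<in>set p. rel_of N a b c"
    "\<forall>(a, b, c)\<in>set q. \<not> rel_of N a b c" for N
  proof -
    have eq: "N 0 [a, b, c] = M 0 [a, b, c]" if "(a, b, c) \<in> S" for a b c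
      using N(2,3) that unfolding p q rel_of_def by blast
    have "N 0 xs \<in> Y xs" if xs: "xs \<in> ?I" for xs
    proof (cases "Y xs = UNIV")
      case False
      obtain a b c where "xs = [a, b, c]" using xs by (auto simp: numeral_3_eq_3 length_Suc_conv)
      then have "N 0 xs = M 0 xs" using False eq by (simp add: S_def)
      then show ?thesis using Y(2) xs by (auto simp: PiE_def)
    qed simp
    moreover have "N \<in> extensional {0}" "N 0 \<in> extensional ?I"
      using N(1) unfolding structures_eq by (auto simp: PiE_def)
    ultimately have "N 0 \<in> Pi\<^sub>E ?I Y" by (auto simp: PiE_def)
    then have "N \<in> Pi\<^sub>E {0} X" using Y(3) \<open>N \<in> extensional {0}\<close> by (auto simp: PiE_def)
    then show ?thesis using X(3) by blast
  qed
  moreover have "\<forall>(a, b, c)\<in>set p. rel_of M a b c" "\<forall>(a, b, c)\<in>set q. \<not> rel_of M a b c"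
    using p q by auto
  ultimately show ?thesis by (intro exI[of _ p] exI[of _ q] conjI ballI impI) simp_all
qed

lemma measurable_into_structures:
  assumes f: "\<And>w. w \<in> space M \<Longrightarrow> f w \<in> structures {0} tern"
    and pred [measurable]: "\<And>a b c. Measurable.pred M (\<lambda>w. rel_of (f w) a b c)"
  shows "f \<in> M \<rightarrow>\<^sub>M borel_of (structure_top {0} tern)"
  unfolding borel_of_def
proof (rule measurable_measure_of)
  show "{U. openin (structure_top {0} tern) U} \<subseteq> Pow (structures {0} tern)" by (auto dest: openin_subset)
  show "f \<in> space M \<rightarrow> structures {0} tern" using f by blast
  fix U assume "U \<in> {U. openin (structure_top {0} tern) U}"
  then have U: "openin (structure_top {0} tern) U" by simp
  define P where "P p q N \<longleftrightarrow> (\<forall>t\<in>set p. case t of (a, b, c) \<Rightarrow> rel_of N a b c) \<and>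
    (\<forall>t\<in>set q. case t of (a, b, c) \<Rightarrow> \<not> rel_of N a b c)" for p q N
  have "f w \<in> U \<longleftrightarrow> (\<exists>p q. (\<forall>N\<in>structures {0} tern. P p q N \<longrightarrow> N \<in> U) \<and> P p q (f w))"
    if w: "w \<in> space M" for w
  proof
    assume "f w \<in> U"
    then show "\<exists>p q. (\<forall>N\<in>structures {0} tern. P p q N \<longrightarrow> N \<in> U) \<and> P p q (f w)"
      using openin_structure_top_nbhd[OF U] unfolding P_def by blast
  next
    assume "\<exists>p q. (\<forall>N\<in>structures {0} tern. P p q N \<longrightarrow> N \<in> U) \<and> P p q (f w)"
    then show "f w \<in> U" using f[OF w] by blast
  qed
  then have "f -` U \<inter> space M =
      {w \<in> space M. \<exists>p q. (\<forall>N\<in>structures {0} tern. P p q N \<longrightarrow> N \<in> U) \<and> P p q (f w)}"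
    by blast
  moreover have [measurable]: "Measurable.pred M (\<lambda>w. P p q (f w))" for p q
    unfolding P_def case_prod_beta by measurable
  have "{w \<in> space M. \<exists>p q. (\<forall>N\<in>structures {0} tern. P p q N \<longrightarrow> N \<in> U) \<and> P p q (f w)} \<in> sets M"
    by measurable
  ultimately show "f -` U \<inter> space M \<in> sets M" by simp
qed

section \<open>The two Borel maps\<close>

definition coset_structure :: "(nat \<Rightarrow> nat) set \<Rightarrow> nat \<Rightarrow> nat list \<Rightarrow> bool" where
  "coset_structure G = str_of (coset_rel (tr G))"

definition group_index :: "(nat \<Rightarrow> nat list \<Rightarrow> bool) \<Rightarrow> nat" where
  "group_index M = (LEAST V. codes_group (rel_of M) V)"

definition group_of :: "(nat \<Rightarrow> nat list \<Rightarrow> bool) \<Rightarrow> (nat \<Rightarrow> nat) set" where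
  "group_of M = pset (action_tr (rel_of M) (group_index M))"

definition coset_structures :: "(nat \<Rightarrow> nat list \<Rightarrow> bool) set" where
  "coset_structures = {M \<in> structures {0} tern. \<exists>V. codes_group (rel_of M) V}"

lemma codes_group_index: "M \<in> coset_structures \<Longrightarrow> codes_group (rel_of M) (group_index M)"
  unfolding coset_structures_def group_index_def using LeastI_ex[of "codes_group (rel_of M)"] by blast

lemma oligo_group_of: "M \<in> coset_structures \<Longrightarrow> oligo_group (group_of M)"
  unfolding group_of_def by (rule oligo_group_action_tr[OF codes_group_index])

lemma presents_group_of: "M \<in> coset_structures \<Longrightarrow> \<exists>F. presents (rel_of M) (group_of M) F"
  unfolding group_of_def by (rule codes_group_presents[OF codes_group_index])

lemma presents_coset_structure: "oligo_group G \<Longrightarrow> \<exists>F. presents (rel_of (coset_structure G)) G F"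
  unfolding coset_structure_def rel_of_str_of using oligo_group.presents_coset_rel by blast

lemma coset_structuresI:
  "oligo_group G \<Longrightarrow> presents (rel_of M) G F \<Longrightarrow> M \<in> structures {0} tern \<Longrightarrow> M \<in> coset_structures"
  unfolding coset_structures_def using presents_codes_group(1) by blast

lemma coset_structure_mem: "oligo_group G \<Longrightarrow> coset_structure G \<in> coset_structures"
  using presents_coset_structure coset_structuresI str_of_structure unfolding coset_structure_def by blast

lemma coset_structures_Borel: "coset_structures \<in> sets (borel_of (structure_top {0} tern))"
proof -
  note [measurable] = pred_codes_group[OF pred_rel_of]
  have "{M \<in> space (borel_of (structure_top {0} tern)). \<exists>V. codes_group (rel_of M) V}
      \<in> sets (borel_of (structure_top {0} tern))"
    by measurable
  then show ?thesis by (simp add: coset_structures_def space_borel_of)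
qed

lemma coset_structure_measurable:
  "coset_structure \<in> restrict_space effros_S_inf oligomorphic_groups
     \<rightarrow>\<^sub>M restrict_space (borel_of (structure_top {0} tern)) coset_structures"
proof (rule measurable_restrict_space2)
  have sp: "space (restrict_space effros_S_inf oligomorphic_groups) = oligomorphic_groups"
    using sets.sets_into_space[OF oligomorphic_groups_Borel] by (auto simp: space_restrict_space)
  then show "coset_structure \<in> space (restrict_space effros_S_inf oligomorphic_groups) \<rightarrow> coset_structures"
    using coset_structure_mem oligomorphic_groups_iff by auto
  have "coset_structure \<in> effros_S_inf \<rightarrow>\<^sub>M borel_of (structure_top {0} tern)"
  proof (rule measurable_into_structures)
    show "coset_structure w \<in> structures {0} tern" for w
      unfolding coset_structure_def by (rule str_of_structure)
    show "Measurable.pred effros_S_inf (\<lambda>w. rel_of (coset_structure w) a b c)" for a b c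
      unfolding coset_structure_def rel_of_str_of by (rule pred_coset_rel[OF pred_tr_effros])
  qed
  then show "coset_structure \<in> restrict_space effros_S_inf oligomorphic_groups
      \<rightarrow>\<^sub>M borel_of (structure_top {0} tern)"
    by (rule measurable_restrict_space1)
qed

lemma group_of_measurable:
  "group_of \<in> restrict_space (borel_of (structure_top {0} tern)) coset_structures
     \<rightarrow>\<^sub>M restrict_space effros_S_inf oligomorphic_groups"
proof (rule measurable_restrict_space2)
  let ?M = "restrict_space (borel_of (structure_top {0} tern)) coset_structures"
  have sp: "space ?M = coset_structures"
    using sets.sets_into_space[OF coset_structures_Borel] by (auto simp: space_restrict_space)
  then show "group_of \<in> space ?M \<rightarrow> oligomorphic_groups"
    using oligo_group_of oligomorphic_groups_iff by auto
  have R: "Measurable.pred ?M (\<lambda>M. rel_of M a b c)" for a b c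
    using pred_rel_of by (rule measurable_restrict_space1)
  note [measurable] = pred_codes_group[OF R]
  have index: "group_index \<in> ?M \<rightarrow>\<^sub>M count_space UNIV"
    unfolding group_index_def[abs_def] by measurable
  show "group_of \<in> ?M \<rightarrow>\<^sub>M effros_S_inf"
  proof (rule measurable_into_effros)
    fix M assume "M \<in> space ?M"
    then have "closed_group (group_of M)" using sp oligo_group_of by (simp add: oligo_group_def)
    then show "closedin S_inf_top (group_of M)" by (simp add: closed_group_iff)
  next
    fix x y
    \<comment> \<open>By \<open>tr_pset\<close> the trace of the rebuilt group is the relation it
      was built from, so measurability of \<open>action_tr\<close> at a measurable index is
      enough.\<close>
    have "tr (group_of M) x y = action_tr (rel_of M) (group_index M) x y" if "M \<in> space ?M" for M
    proof -
      have "orbit_system (action_tr (rel_of M) (group_index M))"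
        using codes_group_index[of M] that sp unfolding codes_group_def good_def by blast
      then show ?thesis unfolding group_of_def by (simp add: tr_pset)
    qed
    moreover have "Measurable.pred ?M (\<lambda>M. action_tr (rel_of M) (group_index M) x y)"
      by (rule pred_at_measurable_nat[OF pred_action_tr[OF R] index])
    ultimately show "Measurable.pred ?M (\<lambda>M. tr (group_of M) x y)"
      by (subst measurable_cong) auto
  qed
qed

text \<open>The source of all four clauses: \<open>coset_structure G\<close> presents
  \<open>G\<close>, and a structure of the class presents the group rebuilt from it.\<close>

lemma structure_iso_iff_top_group_iso:
  assumes G: "oligo_group G" and H: "oligo_group H"
    and M: "presents (rel_of M) G F" and N: "presents (rel_of N) H F'"
  shows "structure_iso {0} tern M N \<longleftrightarrow> top_group_iso G H"
proof -
  have cl: "closed_group G" "closed_group H" using G H by (simp_all add: oligo_group_def)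
  show ?thesis
    unfolding structure_iso_iff top_group_iso_iff[OF cl]
    using presents_iso_tgi[OF G H M N] presents_tgi_iso[OF M N _ cl] by blast
qed

text \<open>After renumbering, \<open>N\<close> presents the same group as \<open>M\<close>, and
  every structure presenting an oligomorphic group has some suitable \<open>V\<close>; this
  \<open>V\<close> need not correspond to the one chosen for \<open>M\<close>.\<close>

lemma iso_invariant_coset_structures: "iso_invariant {0} tern coset_structures"
  unfolding iso_invariant_def
proof (intro ballI impI)
  fix M N assume M: "M \<in> coset_structures" and N: "N \<in> structures {0} tern"
    and iso: "structure_iso {0} tern M N"
  obtain f where f: "bij f" "\<And>a b c. rel_of M a b c \<longleftrightarrow> rel_of N (f a) (f b) (f c)"
    using iso unfolding structure_iso_iff by blast
  obtain F where F: "presents (rel_of M) (group_of M) F" using presents_group_of[OF M] by blast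
  have "presents (rel_of N) (group_of M) (F \<circ> pinv f)"
    by (rule presents_reindex[OF F]) (use f in \<open>simp_all add: bij_imp_bij_inv\<close>)
  then show "N \<in> coset_structures" using coset_structuresI[OF oligo_group_of[OF M]] N by blast
qed

theorem mainTheorem1:
  shows "oligomorphic_groups \<in> sets effros_S_inf \<and>
    (\<exists>(L :: nat set) (ar :: nat \<Rightarrow> nat) (B :: (nat \<Rightarrow> nat list \<Rightarrow> bool) set)
       (\<M> :: (nat \<Rightarrow> nat) set \<Rightarrow> (nat \<Rightarrow> nat list \<Rightarrow> bool))
       (\<G> :: (nat \<Rightarrow> nat list \<Rightarrow> bool) \<Rightarrow> (nat \<Rightarrow> nat) set).
       finite_signature L ar \<and>
       B \<in> sets (borel_of (structure_top L ar)) \<and>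
       iso_invariant L ar B \<and>
       \<M> \<in> restrict_space effros_S_inf oligomorphic_groups
             \<rightarrow>\<^sub>M restrict_space (borel_of (structure_top L ar)) B \<and>
       \<G> \<in> restrict_space (borel_of (structure_top L ar)) B
             \<rightarrow>\<^sub>M restrict_space effros_S_inf oligomorphic_groups \<and>
       (\<forall>G\<in>oligomorphic_groups. top_group_iso (\<G> (\<M> G)) G) \<and>
       (\<forall>M\<in>B. structure_iso L ar (\<M> (\<G> M)) M) \<and>
       (\<forall>G\<in>oligomorphic_groups. \<forall>H\<in>oligomorphic_groups.
          top_group_iso G H \<longleftrightarrow> structure_iso L ar (\<M> G) (\<M> H)) \<and>
       (\<forall>M\<in>B. \<forall>N\<in>B.
          structure_iso L ar M N \<longleftrightarrow> top_group_iso (\<G> M) (\<G> N)))"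
proof (intro conjI exI ballI)
  show "oligomorphic_groups \<in> sets effros_S_inf" by (rule oligomorphic_groups_Borel)
  show "finite_signature {0} tern" by (simp add: finite_signature_def)
  show "coset_structures \<in> sets (borel_of (structure_top {0} tern))" by (rule coset_structures_Borel)
  show "iso_invariant {0} tern coset_structures" by (rule iso_invariant_coset_structures)
  show "coset_structure \<in> restrict_space effros_S_inf oligomorphic_groups
      \<rightarrow>\<^sub>M restrict_space (borel_of (structure_top {0} tern)) coset_structures"
    by (rule coset_structure_measurable)
  show "group_of \<in> restrict_space (borel_of (structure_top {0} tern)) coset_structures
      \<rightarrow>\<^sub>M restrict_space effros_S_inf oligomorphic_groups"
    by (rule group_of_measurable)
  have olig: "oligo_group G" if "G \<in> oligomorphic_groups" for G using that oligomorphic_groups_iff by blast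
  have self_iso: "structure_iso {0} tern M M" for M
    unfolding structure_iso_iff by (rule exI[of _ id]) simp
  \<comment> \<open>One structure presents both groups, so its identity isomorphism gives an
    isomorphism of the groups.\<close>
  show "top_group_iso (group_of (coset_structure G)) G" if "G \<in> oligomorphic_groups" for G
  proof -
    note G = olig[OF that]
    have M: "coset_structure G \<in> coset_structures" by (rule coset_structure_mem[OF G])
    show ?thesis
      using structure_iso_iff_top_group_iso[OF oligo_group_of[OF M] G] presents_group_of[OF M]
        presents_coset_structure[OF G] self_iso by blast
  qed
  \<comment> \<open>Dually, one group is presented by both structures, and its identity map is
    transferred.\<close>
  show "structure_iso {0} tern (coset_structure (group_of M)) M" if M: "M \<in> coset_structures" for M
  proof -
    note H = oligo_group_of[OF M]
    have cl: "closed_group (group_of M)" using H by (simp add: oligo_group_def)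
    have "top_group_iso (group_of M) (group_of M)"
      unfolding top_group_iso_iff[OF cl cl] using tgi_refl by blast
    then show ?thesis
      using structure_iso_iff_top_group_iso[OF H H] presents_group_of[OF M]
        presents_coset_structure[OF H] by blast
  qed
  show "top_group_iso G H \<longleftrightarrow> structure_iso {0} tern (coset_structure G) (coset_structure H)"
    if "G \<in> oligomorphic_groups" "H \<in> oligomorphic_groups" for G H
    using structure_iso_iff_top_group_iso[OF olig olig, OF that] presents_coset_structure olig that by metis
  show "structure_iso {0} tern M N \<longleftrightarrow> top_group_iso (group_of M) (group_of N)"
    if "M \<in> coset_structures" "N \<in> coset_structures" for M N
    using structure_iso_iff_top_group_iso[OF oligo_group_of oligo_group_of, OF that] presents_group_of that by metis
qed

end
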